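(* There is a constant $C>0$ and an algorithm running in time polynomial in $d$ and $m$ such that, if $0<\lambda<1$ satisfies $\lambda\ge\frac{d^{1/4}}{\sqrt m}\,(\log (dm))^{C}$, then the algorithm solves the single-spike block mixtures testing problem with parameters $d,m,\lambda$ with high probability: given $y_1,\dots,y_{md}\in\mathbb R^d$, it outputs "null" with probability $1-o(1)$ when the input is drawn from the null distribution and "planted" with probability $1-o(1)$ when the input is drawn from the planted distribution, where $o(1)\to0$ as $d\to\infty$.
   Context: Single-spike block mixtures testing problem. Let $d,m\in\mathbb N$ and $0<\lambda<1$. The goal is to distinguish, given $y_1,\dots,y_{md}\in\mathbb R^d$, between: Null: $y_1,\dots,y_{md}\sim\mathcal N(0,\mathrm{Id})$ i.i.d. Planted: first $x\sim\{\pm1/\sqrt d\}^d$ and $s_1,\dots,s_d\sim\{\pm1\}$ are drawn uniformly and independently. Then, conditionally on $x,s$, the $y_j$ are independent and the $md$ vectors are split into $d$ consecutive blocks of $m$ vectors, where every vector in the $i$-th block is distributed as $\mathcal N(0,\mathrm{Id}+s_i\lambda xx^\top)$. *)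

theory Defs
  imports "HOL-Probability.Probability"
begin

text \<open>A vector in \<open>R^d\<close> is a function \<open>nat \<Rightarrow> real\<close> in the space of
  \<open>PiM {..<d} (\<lambda>_. borel)\<close>; matrices are functions \<open>nat \<Rightarrow> nat \<Rightarrow> real\<close> of which
  only the entries with indices below \<open>d\<close> matter.\<close>

definition std_gaussian :: "nat \<Rightarrow> (nat \<Rightarrow> real) measure" where
  "std_gaussian d = PiM {..<d} (\<lambda>_. density lborel std_normal_density)"

definition mat_vec :: "nat \<Rightarrow> (nat \<Rightarrow> nat \<Rightarrow> real) \<Rightarrow> (nat \<Rightarrow> real) \<Rightarrow> nat \<Rightarrow> real" where
  "mat_vec d A z = (\<lambda>i\<in>{..<d}. \<Sum>k<d. A i k * z k)"

definition is_factor :: "nat \<Rightarrow> (nat \<Rightarrow> nat \<Rightarrow> real) \<Rightarrow> (nat \<Rightarrow> nat \<Rightarrow> real) \<Rightarrow> bool" where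
  "is_factor d A S \<longleftrightarrow> (\<forall>i<d. \<forall>j<d. (\<Sum>k<d. A i k * A j k) = S i j)"

text \<open>\<open>N(0, S)\<close> for a positive semidefinite \<open>S\<close>: the law of \<open>A z\<close> with \<open>z\<close> standard normal and
  \<open>A A\<^sup>T = S\<close>. The law does not depend on which such \<open>A\<close> is chosen.
  For \<open>S\<close> not positive semidefinite the term has no meaning.\<close>

definition gaussian :: "nat \<Rightarrow> (nat \<Rightarrow> nat \<Rightarrow> real) \<Rightarrow> (nat \<Rightarrow> real) measure" where
  "gaussian d S = distr (std_gaussian d) (PiM {..<d} (\<lambda>_. borel)) (mat_vec d (SOME A. is_factor d A S))"

definition spiked_cov :: "real \<Rightarrow> (nat \<Rightarrow> real) \<Rightarrow> nat \<Rightarrow> nat \<Rightarrow> real" where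
  "spiked_cov c x = (\<lambda>i j. (if i = j then 1 else 0) + c * x i * x j)"

lemma spiked_cov_has_factor:
  assumes "(\<Sum>i<d. (x i)\<^sup>2) = 1" and "-1 \<le> c"
  shows "\<exists>A. is_factor d A (spiked_cov c x)"
proof -
  define b where "b = sqrt (1 + c) - 1"
  have b: "2 * b + b\<^sup>2 = c"
    using assms(2) by (simp add: b_def power2_diff algebra_simps)
  have "(\<Sum>k<d. spiked_cov b x i k * spiked_cov b x j k) = spiked_cov c x i j"
    if "i < d" "j < d" for i j
  proof -
    have "(\<Sum>k<d. spiked_cov b x i k * spiked_cov b x j k) =
      (\<Sum>k<d. (if k = i then (if i = j then 1 else 0) else 0) + (if k = i then b * x j * x i else 0)
        + (if k = j then b * x i * x j else 0) + b\<^sup>2 * x i * x j * (x k)\<^sup>2)"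
      by (rule sum.cong) (auto simp: spiked_cov_def algebra_simps power2_eq_square)
    also have "\<dots> = (if i = j then 1 else 0) + (2 * b + b\<^sup>2) * x i * x j"
      using that assms(1) by (simp add: sum.distrib sum_distrib_left[symmetric] algebra_simps)
    finally show ?thesis by (simp add: b spiked_cov_def)
  qed
  then show ?thesis unfolding is_factor_def by blast
qed

text \<open>Samples are indexed by \<open>j < m * d\<close>; \<open>y j k\<close> is the \<open>k\<close>-th coordinate of the \<open>j\<close>-th vector.
  Sample \<open>j\<close> lies in block \<open>j div m\<close>.\<close>

definition null_dist :: "nat \<Rightarrow> nat \<Rightarrow> (nat \<Rightarrow> nat \<Rightarrow> real) measure" where
  "null_dist d m = PiM {..<m * d} (\<lambda>_. std_gaussian d)"

definition spike_prior :: "nat \<Rightarrow> (nat \<Rightarrow> real) pmf" where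
  "spike_prior d = pmf_of_set (PiE {..<d} (\<lambda>_. {1 / sqrt d, - 1 / sqrt d}))"

definition sign_prior :: "nat \<Rightarrow> (nat \<Rightarrow> real) pmf" where
  "sign_prior d = pmf_of_set (PiE {..<d} (\<lambda>_. {1, -1}))"

definition planted_dist :: "nat \<Rightarrow> nat \<Rightarrow> real \<Rightarrow> (nat \<Rightarrow> nat \<Rightarrow> real) measure" where
  "planted_dist d m lam =
     measure_pmf (pair_pmf (spike_prior d) (sign_prior d)) \<bind>
       (\<lambda>(x, s). PiM {..<m * d} (\<lambda>j. gaussian d (spiked_cov (s (j div m) * lam) x)))"

text \<open>A real RAM: a memory of natural numbers \<open>I\<close> (counters and addresses), a memory of
  reals \<open>R\<close>, and a read-only real input array. Real arithmetic is exact and every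
  instruction and test costs one step. There is no rounding from reals to integers, the
  integer instructions do not include multiplication, and the only real constants are integers.
  Programs are while programs.\<close>

type_synonym state = "(nat \<Rightarrow> nat) \<times> (nat \<Rightarrow> real)"

datatype instr =
    IConst nat nat
  | IAdd nat nat nat
  | ISub nat nat nat
  | ILoad nat nat
  | IStore nat nat
  | RConst nat int
  | ROfI nat nat
  | RAdd nat nat nat
  | RSub nat nat nat
  | RMul nat nat nat
  | RDiv nat nat nat
  | RLoad nat nat
  | RStore nat nat
  | RInput nat nat nat

fun step :: "(nat \<Rightarrow> nat \<Rightarrow> real) \<Rightarrow> instr \<Rightarrow> state \<Rightarrow> state" where
  "step inp (IConst a k) (I, R) = (I(a := k), R)"
| "step inp (IAdd a b c) (I, R) = (I(a := I b + I c), R)"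
| "step inp (ISub a b c) (I, R) = (I(a := I b - I c), R)"
| "step inp (ILoad a b) (I, R) = (I(a := I (I b)), R)"
| "step inp (IStore a b) (I, R) = (I(I a := I b), R)"
| "step inp (RConst a k) (I, R) = (I, R(a := of_int k))"
| "step inp (ROfI a b) (I, R) = (I, R(a := real (I b)))"
| "step inp (RAdd a b c) (I, R) = (I, R(a := R b + R c))"
| "step inp (RSub a b c) (I, R) = (I, R(a := R b - R c))"
| "step inp (RMul a b c) (I, R) = (I, R(a := R b * R c))"
| "step inp (RDiv a b c) (I, R) = (I, R(a := R b / R c))"
| "step inp (RLoad a b) (I, R) = (I, R(a := R (I b)))"
| "step inp (RStore a b) (I, R) = (I, R(I a := R b))"
| "step inp (RInput a b c) (I, R) = (I, R(a := inp (I b) (I c)))"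

datatype test = ILess nat nat | RLess nat nat

fun holds :: "test \<Rightarrow> state \<Rightarrow> bool" where
  "holds (ILess a b) (I, R) \<longleftrightarrow> I a < I b"
| "holds (RLess a b) (I, R) \<longleftrightarrow> R a < R b"

datatype prog =
    Skip
  | Do instr
  | Seq prog prog
  | Cond test prog prog
  | Loop test prog

text \<open>\<open>exec inp p s t s'\<close>: started in \<open>s\<close>, program \<open>p\<close> terminates in \<open>s'\<close> after \<open>t\<close> steps.\<close>

inductive exec :: "(nat \<Rightarrow> nat \<Rightarrow> real) \<Rightarrow> prog \<Rightarrow> state \<Rightarrow> nat \<Rightarrow> state \<Rightarrow> bool"
  for inp :: "nat \<Rightarrow> nat \<Rightarrow> real" where
  exec_Skip: "exec inp Skip s 1 s"
| exec_Do: "exec inp (Do i) s 1 (step inp i s)"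
| exec_Seq: "exec inp p s t1 s1 \<Longrightarrow> exec inp q s1 t2 s2 \<Longrightarrow> exec inp (Seq p q) s (t1 + t2) s2"
| exec_CondT: "holds b s \<Longrightarrow> exec inp p s t s' \<Longrightarrow> exec inp (Cond b p q) s (1 + t) s'"
| exec_CondF: "\<not> holds b s \<Longrightarrow> exec inp q s t s' \<Longrightarrow> exec inp (Cond b p q) s (1 + t) s'"
| exec_LoopF: "\<not> holds b s \<Longrightarrow> exec inp (Loop b p) s 1 s"
| exec_LoopT: "holds b s \<Longrightarrow> exec inp p s t1 s1 \<Longrightarrow> exec inp (Loop b p) s1 t2 s2 \<Longrightarrow>
    exec inp (Loop b p) s (1 + t1 + t2) s2"

lemma exec_deterministic:
  assumes "exec inp p s t s'" and "exec inp p s u s''"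
  shows "u = t \<and> s'' = s'"
  using assms
proof (induction arbitrary: u s'' rule: exec.induct)
  case (exec_Skip s)
  then show ?case by (auto elim: exec.cases)
next
  case (exec_Do i s)
  then show ?case by (auto elim: exec.cases)
next
  case (exec_Seq p s t1 s1 q t2 s2)
  from exec_Seq.prems show ?case by cases (use exec_Seq.IH in blast)
next
  case (exec_CondT b s p t s' q)
  from exec_CondT.prems show ?case by cases (use exec_CondT.IH exec_CondT.hyps in blast)+
next
  case (exec_CondF b s q t s' p)
  from exec_CondF.prems show ?case by cases (use exec_CondF.IH exec_CondF.hyps in blast)+
next
  case (exec_LoopF b s p)
  from exec_LoopF.prems show ?case by cases (use exec_LoopF.hyps in blast)+
next
  case (exec_LoopT b s p t1 s1 t2 s2)
  from exec_LoopT.prems show ?case by cases (use exec_LoopT.IH exec_LoopT.hyps in blast)+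
qed

datatype verdict = Null | Planted

text \<open>The dimensions are supplied in \<open>I[0]\<close> and \<open>I[1]\<close>; the verdict is read off \<open>I[0]\<close>.
  The parameter \<open>\<lambda>\<close> is not part of the input.\<close>

definition initial :: "nat \<Rightarrow> nat \<Rightarrow> state" where
  "initial d m = ((\<lambda>_. 0)(0 := d, 1 := m), \<lambda>_. 0)"

definition verdict :: "state \<Rightarrow> verdict" where
  "verdict s = (if fst s 0 = 0 then Null else Planted)"

definition input_array :: "nat \<Rightarrow> nat \<Rightarrow> (nat \<Rightarrow> nat \<Rightarrow> real) \<Rightarrow> nat \<Rightarrow> nat \<Rightarrow> real" where
  "input_array d m y j k = (if j < m * d \<and> k < d then y j k else 0)"

text \<open>One program works for all \<open>d\<close>, \<open>m\<close> and all inputs, and the time bound is worst case.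
  A bound polynomial in \<open>d, m \<ge> 1\<close> is one of the form \<open>K (d + m)^k\<close>.\<close>

definition poly_time_test :: "(nat \<Rightarrow> nat \<Rightarrow> (nat \<Rightarrow> nat \<Rightarrow> real) \<Rightarrow> verdict) \<Rightarrow> bool" where
  "poly_time_test \<A> \<longleftrightarrow> (\<exists>p K k. \<forall>d\<ge>1. \<forall>m\<ge>1. \<forall>y. \<exists>t s.
     exec (input_array d m y) p (initial d m) t s \<and> t \<le> K * (d + m) ^ k \<and> \<A> d m y = verdict s)"

text \<open>\<open>measure\<close> is 0 on non-measurable sets, so the bounds below include measurability
  of the two events.\<close>

definition solves_testing ::
    "(nat \<Rightarrow> nat \<Rightarrow> (nat \<Rightarrow> nat \<Rightarrow> real) \<Rightarrow> verdict) \<Rightarrow> nat \<Rightarrow> nat \<Rightarrow> real \<Rightarrow> real \<Rightarrow> bool" where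
  "solves_testing \<A> d m lam \<delta> \<longleftrightarrow>
     measure (null_dist d m) {y \<in> space (null_dist d m). \<A> d m y = Null} \<ge> 1 - \<delta> \<and>
     measure (planted_dist d m lam) {y \<in> space (planted_dist d m lam). \<A> d m y = Planted} \<ge> 1 - \<delta>"

end

theory Submission
  imports Defs "HOL-Library.Log_Nat" "HOL-Real_Asymp.Real_Asymp"
begin

text \<open>Split every block of \<open>m\<close> samples into two halves of \<open>n\<close> samples each, let \<open>P\<close> and \<open>Q\<close> be the
  matrices \<open>\<Sum> y y\<^sup>T\<close> of the two halves, and let \<open>T\<close> be the sum over the blocks of
  \<open>\<Sum>\<^bsub>b<a\<^esub> P\<^bsub>ab\<^esub> Q\<^bsub>ab\<^esub>\<close>. The unknown signs enter squared, so
  \<open>E T = n\<^sup>2 \<lambda>\<^sup>2 (d - 1) / 2\<close> (which is 0 under the null), and Wick's formula gives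
  \<open>Var T \<le> 64 n\<^sup>2 d\<^sup>3 + 16 n\<^sup>3 \<lambda>\<^sup>2 d\<close>. Comparing \<open>T\<^sup>2\<close> with \<open>n\<^sup>2 d\<^sup>3\<close> times a slowly growing
  function of \<open>d\<close> separates the two cases by Chebyshev as soon as \<open>n \<lambda>\<^sup>2\<close> is much larger than
  \<open>\<surd>d\<close>, and the threshold does not involve \<open>\<lambda>\<close>.\<close>

section \<open>Running times of real RAM programs\<close>

text \<open>All samples of a block share one sign, so \<open>P_ab\<close> and \<open>Q_ab\<close>
  both have mean n s_i lam x_a x_b for b < a. They are independent, so their product has mean
  exactly the square of this; squaring a single entry would add its own variance, of order n, as a
  bias. The diagonal is left out because its entries have mean close to n under both hypotheses.
  Hence the statistic needs no centring and can be formed without x, s or lam.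

  The noise of one block has standard deviation of order n d, that of d independent blocks n
  d^(3/2), while the means, about n^2 lam^2 / 2 each, add up linearly. The ratio n lam^2 / sqrt d is
  the origin of the scale d^(1/4) / sqrt m.

  The moment bounds see x only through |x_a x_b| = 1/d, so they hold conditionally on every x and s,
  and averaging over the prior costs nothing. The test compares T^2 instead of T because the
  threshold for T contains square roots, which the machine does not compute; a large negative T then
  also counts as planted, which two-sided Chebyshev covers.\<close>

definition triple ::
    "(nat \<Rightarrow> nat \<Rightarrow> real) \<Rightarrow> (state \<Rightarrow> bool) \<Rightarrow> prog \<Rightarrow> nat \<Rightarrow> (state \<Rightarrow> bool) \<Rightarrow> bool" where
  "triple inp P p B Q \<longleftrightarrow> (\<forall>s. P s \<longrightarrow> (\<exists>t s'. exec inp p s t s' \<and> t \<le> B \<and> Q s'))"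

lemma tripleI:
  assumes "\<And>s. P s \<Longrightarrow> \<exists>t s'. exec inp p s t s' \<and> t \<le> B \<and> Q s'"
  shows "triple inp P p B Q"
  using assms unfolding triple_def by blast

lemma triple_weaken:
  assumes "triple inp P p B Q" "\<And>s. P' s \<Longrightarrow> P s" "\<And>s. Q s \<Longrightarrow> Q' s" "B \<le> B'"
  shows "triple inp P' p B' Q'"
  using assms unfolding triple_def by (meson le_trans)

lemma triple_Seq:
  assumes "triple inp P p B Q" "triple inp Q q B' R"
  shows "triple inp P (Seq p q) (B + B') R"
proof (rule tripleI)
  fix s assume "P s"
  then obtain t s1 where 1: "exec inp p s t s1" "t \<le> B" "Q s1"
    using assms(1) unfolding triple_def by blast
  then obtain u s2 where 2: "exec inp q s1 u s2" "u \<le> B'" "R s2"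
    using assms(2) unfolding triple_def by blast
  show "\<exists>t s'. exec inp (Seq p q) s t s' \<and> t \<le> B + B' \<and> R s'"
    using exec_Seq[OF 1(1) 2(1)] add_mono[OF 1(2) 2(2)] 2(3) by blast
qed

lemma triple_Cond:
  assumes "triple inp (\<lambda>s. P s \<and> holds b s) p B Q" "triple inp (\<lambda>s. P s \<and> \<not> holds b s) q B Q"
  shows "triple inp P (Cond b p q) (1 + B) Q"
proof (rule tripleI)
  fix s assume P: "P s"
  show "\<exists>t s'. exec inp (Cond b p q) s t s' \<and> t \<le> 1 + B \<and> Q s'"
  proof (cases "holds b s")
    case True
    then obtain t s' where 1: "exec inp p s t s'" "t \<le> B" "Q s'"
      using assms(1) P unfolding triple_def by blast
    have "1 + t \<le> 1 + B" using 1(2) by simp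
    then show ?thesis using exec_CondT[OF True 1(1)] 1(3) by blast
  next
    case False
    then obtain t s' where 1: "exec inp q s t s'" "t \<le> B" "Q s'"
      using assms(2) P unfolding triple_def by blast
    have "1 + t \<le> 1 + B" using 1(2) by simp
    then show ?thesis using exec_CondF[OF False 1(1)] 1(3) by blast
  qed
qed

text \<open>The invariant carries the number \<open>k\<close> of finished rounds and the guard
  decides \<open>k < N\<close> exactly, so termination and the time bound come together. The 1 in
  each round pays for its test, the leading 1 for the last, failing test.\<close>

lemma triple_Loop:
  assumes guard: "\<And>k s. k \<le> N \<Longrightarrow> P k s \<Longrightarrow> holds b s \<longleftrightarrow> k < N"
    and body: "\<And>k. k < N \<Longrightarrow> triple inp (P k) p B (P (Suc k))"
  shows "triple inp (P 0) (Loop b p) (1 + N * (1 + B)) (P N)"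
proof -
  \<comment> \<open>Induction on the rounds still to come, because \<open>exec_LoopT\<close> peels
    off the first round.\<close>
  have "triple inp (P (N - k)) (Loop b p) (1 + k * (1 + B)) (P N)" if "k \<le> N" for k
    using that
  proof (induction k)
    case 0
    show ?case
    proof (rule tripleI)
      fix s assume "P (N - 0) s"
      then have "P N s" by simp
      moreover have "exec inp (Loop b p) s 1 s"
        using guard[OF le_refl \<open>P N s\<close>] by (intro exec_LoopF) simp
      ultimately show "\<exists>t s'. exec inp (Loop b p) s t s' \<and> t \<le> 1 + 0 * (1 + B) \<and> P N s'"
        using \<open>P N s\<close> by (metis mult_0 add_0_right le_refl)
    qed
  next
    case (Suc k)
    show ?case
    proof (rule tripleI)
      fix s assume P: "P (N - Suc k) s"
      have lt: "N - Suc k < N" and eq: "Suc (N - Suc k) = N - k" using Suc.prems by auto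
      have b: "holds b s" using guard[OF _ P] lt by simp
      obtain t s1 where 1: "exec inp p s t s1" "t \<le> B" "P (N - k) s1"
        using body[OF lt] P unfolding triple_def eq by blast
      obtain u s2 where 2: "exec inp (Loop b p) s1 u s2" "u \<le> 1 + k * (1 + B)" "P N s2"
        using Suc 1(3) unfolding triple_def by (meson Suc_leD)
      have "1 + t + u \<le> 1 + Suc k * (1 + B)" using 1(2) 2(2) by simp
      then show "\<exists>t s'. exec inp (Loop b p) s t s' \<and> t \<le> 1 + Suc k * (1 + B) \<and> P N s'"
        using exec_LoopT[OF b 1(1) 2(1)] 2(3) by blast
    qed
  qed
  from this[of N] show ?thesis by simp
qed

fun block :: "instr list \<Rightarrow> prog" where
  "block [] = Skip"
| "block (i # is) = Seq (Do i) (block is)"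

lemma exec_block: "exec inp (block is) s (length is + 1) (fold (step inp) is s)"
proof (induction "is" arbitrary: s)
  case Nil
  show ?case by (simp add: exec_Skip[simplified])
next
  case (Cons i "is")
  show ?case using exec_Seq[OF exec_Do Cons.IH] by simp
qed

text \<open>Straight-line code is executed symbolically by simplifying
  \<open>fold (step inp)\<close>. The bound is strict because the closing \<open>Skip\<close> costs
  a step too.\<close>

lemma triple_block:
  assumes "\<And>I R. P (I, R) \<Longrightarrow> Q (fold (step inp) is (I, R))" "length is < B"
  shows "triple inp P (block is) B Q"
proof (rule tripleI)
  fix s assume "P s"
  then have "Q (fold (step inp) is s)" using assms(1) by (cases s) simp
  then show "\<exists>t s'. exec inp (block is) s t s' \<and> t \<le> B \<and> Q s'"
    using exec_block[of inp "is" s] assms(2) by (intro exI[of _ "length is + 1"] exI) auto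
qed

section \<open>The test and its program\<close>

definition half_sum ::
    "nat \<Rightarrow> nat \<Rightarrow> (nat \<Rightarrow> nat \<Rightarrow> real) \<Rightarrow> nat \<Rightarrow> nat \<Rightarrow> real" where
  "half_sum n u y a b = (\<Sum>j<n. y (u + j) a * y (u + j) b)"

text \<open>With \<open>n = m div 2\<close> and \<open>m\<close> odd, the last sample of the block
  is left out, which keeps the halves equal in size.\<close>

definition block_stat ::
    "nat \<Rightarrow> nat \<Rightarrow> nat \<Rightarrow> nat \<Rightarrow> (nat \<Rightarrow> nat \<Rightarrow> real) \<Rightarrow> real" where
  "block_stat d m n i y =
     (\<Sum>a<d. \<Sum>b<a. half_sum n (i * m) y a b * half_sum n (i * m + n) y a b)"

definition stat :: "nat \<Rightarrow> nat \<Rightarrow> (nat \<Rightarrow> nat \<Rightarrow> real) \<Rightarrow> real" where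
  "stat d m y = (\<Sum>i<d. block_stat d m (m div 2) i y)"

text \<open>The factor \<^term>\<open>ceillog2 d\<close> may be replaced by anything unbounded that grows more slowly
  than \<open>(ln d) ^ 4\<close> and is computable without rounding a real number.\<close>

definition spike_test :: "nat \<Rightarrow> nat \<Rightarrow> (nat \<Rightarrow> nat \<Rightarrow> real) \<Rightarrow> verdict" where
  "spike_test d m y =
     (if real (m div 2) ^ 2 * real d ^ 3 * real (ceillog2 d) < stat d m y ^ 2
      then Planted else Null)"

text \<open>Both halves fit into their block, so the statistic reads only genuine entries. This
  allows the program, which sees the padded array, to decide the test on \<open>y\<close>
  itself.\<close>

lemma stat_input_array: "stat d m (input_array d m y) = stat d m y"
proof -
  have "i * m + j < m * d" if "i < d" "j < m" for i j
  proof -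
    have "i * m + j < Suc i * m" using that by simp
    also have "\<dots> \<le> d * m" using that by (intro mult_le_mono1) simp
    finally show ?thesis by (simp add: mult.commute)
  qed
  then have "half_sum (m div 2) (i * m) (input_array d m y) a b = half_sum (m div 2) (i * m) y a b"
    and "half_sum (m div 2) (i * m + m div 2) (input_array d m y) a b =
      half_sum (m div 2) (i * m + m div 2) y a b"
    if "i < d" "a < d" "b < a" for i a b
    using that unfolding half_sum_def input_array_def
    by (auto intro!: sum.cong simp: add.assoc)
  then show ?thesis unfolding stat_def block_stat_def by (auto intro!: sum.cong)
qed

text \<open>Register \<open>I[10]\<close> holds the constant 1. The halved block length goes to \<open>I[2]\<close> and
  \<^term>\<open>ceillog2 d\<close> to \<open>I[11]\<close>.\<close>

definition pre_prog :: prog where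
  "pre_prog = Seq (block [IConst 10 1, IConst 7 1])
    (Seq (Loop (ILess 7 1) (block [IAdd 2 2 10, IAdd 7 7 10, IAdd 7 7 10]))
    (Seq (block [IConst 12 1])
      (Loop (ILess 12 0) (block [IAdd 12 12 12, IAdd 11 11 10]))))"

text \<open>\<open>I[3]\<close> is the block \<open>i\<close> and \<open>I[4]\<close> its first
  sample \<open>i * m\<close>, maintained by addition since integers cannot be multiplied.
  \<open>I[5]\<close> and \<open>I[6]\<close> are the matrix indices, \<open>I[8]\<close> and
  \<open>I[9]\<close> run through the samples of the two halves, \<open>R[1]\<close> and
  \<open>R[2]\<close> collect the two entries, and \<open>R[0]\<close> accumulates the
  statistic.\<close>

definition entry_prog :: prog where
  "entry_prog = Seq (block [RConst 1 0, RConst 2 0, IConst 7 0, IAdd 8 4 7, IAdd 9 4 2])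
    (Seq (Loop (ILess 7 2) (block
      [RInput 3 8 5, RInput 4 8 6, RMul 3 3 4, RAdd 1 1 3,
       RInput 3 9 5, RInput 4 9 6, RMul 3 3 4, RAdd 2 2 3,
       IAdd 7 7 10, IAdd 8 8 10, IAdd 9 9 10]))
     (block [RMul 1 1 2, RAdd 0 0 1, IAdd 6 6 10]))"

definition row_prog :: prog where
  "row_prog = Seq (block [IConst 6 0]) (Seq (Loop (ILess 6 5) entry_prog) (block [IAdd 5 5 10]))"

definition block_prog :: prog where
  "block_prog = Seq (block [IConst 5 0])
     (Seq (Loop (ILess 5 0) row_prog) (block [IAdd 3 3 10, IAdd 4 4 1]))"

text \<open>The counters are converted to reals before they are multiplied, as only reals have a
  product instruction.\<close>

definition decide_prog :: prog where
  "decide_prog = Seq (block [ROfI 1 2, ROfI 2 0, ROfI 3 11, RMul 1 1 1,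
       RMul 4 2 2, RMul 4 4 2, RMul 1 1 4, RMul 1 1 3, RMul 0 0 0])
     (Cond (RLess 1 0) (block [IConst 0 1]) (block [IConst 0 0]))"

definition test_prog :: prog where
  "test_prog = Seq pre_prog (Seq (Loop (ILess 3 0) block_prog) decide_prog)"

definition ready :: "nat \<Rightarrow> nat \<Rightarrow> state \<Rightarrow> bool" where
  "ready d m s \<longleftrightarrow> fst s 0 = d \<and> fst s 1 = m \<and> fst s 2 = m div 2 \<and> fst s 10 = 1 \<and>
     fst s 11 = ceillog2 d"

lemma triple_pre_prog:
  assumes "1 \<le> d"
  shows "triple inp (\<lambda>s. s = initial d m) pre_prog (12 + 5 * m + 4 * d)
     (\<lambda>s. ready d m s \<and> fst s 3 = 0 \<and> fst s 4 = 0 \<and> snd s 0 = 0)"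
proof -
  define base where "base = (\<lambda>s::state. fst s 0 = d \<and> fst s 1 = m \<and> fst s 10 = 1 \<and> fst s 3 = 0
    \<and> fst s 4 = 0 \<and> snd s 0 = 0)"
  define P where "P = (\<lambda>k s. base s \<and> fst s 11 = 0 \<and> fst s 2 = k \<and> fst s 7 = 2 * k + 1)"
  define Q where "Q = (\<lambda>k s. base s \<and> fst s 2 = m div 2 \<and> fst s 11 = k \<and> fst s 12 = 2 ^ k)"
  have 1: "triple inp (\<lambda>s. s = initial d m) (block [IConst 10 1, IConst 7 1]) 3 (P 0)"
    by (rule triple_block) (auto simp: initial_def P_def base_def)
  have 2: "triple inp (P 0)
      (Loop (ILess 7 1) (block [IAdd 2 2 10, IAdd 7 7 10, IAdd 7 7 10]))
      (1 + (m div 2) * (1 + 4)) (P (m div 2))"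
  proof (rule triple_Loop)
    \<comment> \<open>\<open>2 * k + 1 < m\<close> is equivalent to \<open>k < m div 2\<close> for
      either parity of \<open>m\<close>; this is why \<open>I[7]\<close> starts at 1.\<close>
    show "holds (ILess 7 1) s \<longleftrightarrow> k < m div 2" if "P k s" for k s
      using that by (cases s) (auto simp: P_def base_def)
    show "triple inp (P k) (block [IAdd 2 2 10, IAdd 7 7 10, IAdd 7 7 10]) 4 (P (Suc k))" for k
      by (rule triple_block) (auto simp: P_def base_def)
  qed
  have 3: "triple inp (P (m div 2)) (block [IConst 12 1]) 2 (Q 0)"
    by (rule triple_block) (auto simp: P_def Q_def base_def)
  have 4: "triple inp (Q 0) (Loop (ILess 12 0) (block [IAdd 12 12 12, IAdd 11 11 10]))
      (1 + ceillog2 d * (1 + 3)) (Q (ceillog2 d))"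
  proof (rule triple_Loop)
    show "holds (ILess 12 0) s \<longleftrightarrow> k < ceillog2 d" if "Q k s" for k s
      using that ceillog2_le_iff[of d k] assms by (cases s) (auto simp: Q_def base_def)
    show "triple inp (Q k) (block [IAdd 12 12 12, IAdd 11 11 10]) 3 (Q (Suc k))" for k
      by (rule triple_block) (auto simp: Q_def base_def)
  qed
  have "ceillog2 d \<le> d"
    using assms by (simp add: ceillog2_le_iff less_imp_le)
  then show ?thesis unfolding pre_prog_def
    by (intro triple_weaken[OF triple_Seq[OF 1 triple_Seq[OF 2 triple_Seq[OF 3 4]]]])
      (auto simp: Q_def base_def ready_def)
qed

text \<open>The accumulator on entry is a free parameter \<open>T\<close>, to be instantiated by the
  enclosing loops with their own partial sums.\<close>

lemma triple_entry_prog: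
  "triple inp
     (\<lambda>s. ready d m s \<and> fst s 3 = i \<and> fst s 4 = i * m \<and> fst s 5 = a \<and> fst s 6 = b \<and> snd s 0 = T)
     entry_prog (11 + 13 * m)
     (\<lambda>s. ready d m s \<and> fst s 3 = i \<and> fst s 4 = i * m \<and> fst s 5 = a \<and> fst s 6 = Suc b \<and>
        snd s 0 = T + half_sum (m div 2) (i * m) inp a b * half_sum (m div 2) (i * m + m div 2) inp a b)"
    (is "triple inp ?P _ _ ?Q")
proof -
  define J where "J = (\<lambda>k s. ready d m s \<and> fst s 3 = i \<and> fst s 4 = i * m \<and> fst s 5 = a \<and> fst s 6 = b
    \<and> snd s 0 = T \<and> fst s 7 = k \<and> fst s 8 = i * m + k \<and> fst s 9 = i * m + m div 2 + k
    \<and> snd s 1 = half_sum k (i * m) inp a b \<and> snd s 2 = half_sum k (i * m + m div 2) inp a b)"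
  have 1: "triple inp ?P (block [RConst 1 0, RConst 2 0, IConst 7 0, IAdd 8 4 7, IAdd 9 4 2]) 6 (J 0)"
    by (rule triple_block) (auto simp: J_def ready_def half_sum_def)
  let ?body = "[RInput 3 8 5, RInput 4 8 6, RMul 3 3 4, RAdd 1 1 3,
       RInput 3 9 5, RInput 4 9 6, RMul 3 3 4, RAdd 2 2 3,
       IAdd 7 7 10, IAdd 8 8 10, IAdd 9 9 10]"
  have 2: "triple inp (J 0) (Loop (ILess 7 2) (block ?body)) (1 + (m div 2) * (1 + 12)) (J (m div 2))"
  proof (rule triple_Loop)
    show "holds (ILess 7 2) s \<longleftrightarrow> k < m div 2" if "J k s" for k s
      using that by (cases s) (auto simp: J_def ready_def)
    show "triple inp (J k) (block ?body) 12 (J (Suc k))" for k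
      by (rule triple_block) (auto simp: J_def ready_def half_sum_def)
  qed
  have 3: "triple inp (J (m div 2)) (block [RMul 1 1 2, RAdd 0 0 1, IAdd 6 6 10]) 4 ?Q"
    by (rule triple_block) (auto simp: J_def ready_def)
  show ?thesis unfolding entry_prog_def
    by (rule triple_weaken[OF triple_Seq[OF 1 triple_Seq[OF 2 3]]]) auto
qed

lemma triple_row_prog:
  assumes "a < d"
  shows "triple inp
     (\<lambda>s. ready d m s \<and> fst s 3 = i \<and> fst s 4 = i * m \<and> fst s 5 = a \<and> snd s 0 = T)
     row_prog (5 + d * (12 + 13 * m))
     (\<lambda>s. ready d m s \<and> fst s 3 = i \<and> fst s 4 = i * m \<and> fst s 5 = Suc a \<and>
        snd s 0 = T + (\<Sum>b<a. half_sum (m div 2) (i * m) inp a b *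
          half_sum (m div 2) (i * m + m div 2) inp a b))"
    (is "triple inp ?P _ _ ?Q")
proof -
  define J where "J = (\<lambda>k s. ready d m s \<and> fst s 3 = i \<and> fst s 4 = i * m \<and> fst s 5 = a \<and> fst s 6 = k
    \<and> snd s 0 = T + (\<Sum>b<k. half_sum (m div 2) (i * m) inp a b *
          half_sum (m div 2) (i * m + m div 2) inp a b))"
  have 1: "triple inp ?P (block [IConst 6 0]) 2 (J 0)"
    by (rule triple_block) (auto simp: J_def ready_def)
  have 2: "triple inp (J 0) (Loop (ILess 6 5) entry_prog) (1 + a * (1 + (11 + 13 * m))) (J a)"
  proof (rule triple_Loop)
    show "holds (ILess 6 5) s \<longleftrightarrow> k < a" if "J k s" for k s
      using that by (cases s) (auto simp: J_def ready_def)
    show "triple inp (J k) entry_prog (11 + 13 * m) (J (Suc k))" for k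
      by (rule triple_weaken[OF triple_entry_prog[where i = i and a = a and b = k and
            T = "T + (\<Sum>b<k. half_sum (m div 2) (i * m) inp a b *
              half_sum (m div 2) (i * m + m div 2) inp a b)"]]) (auto simp: J_def)
  qed
  have 3: "triple inp (J a) (block [IAdd 5 5 10]) 2 ?Q"
    by (rule triple_block) (auto simp: J_def ready_def)
  \<comment> \<open>Row \<open>a\<close> has only \<open>a\<close> entries, but the loop over the
    rows wants one bound for all of them.\<close>
  have "a * (12 + 13 * m) \<le> d * (12 + 13 * m)" using assms by simp
  then show ?thesis unfolding row_prog_def
    by (intro triple_weaken[OF triple_Seq[OF 1 triple_Seq[OF 2 3]]]) auto
qed

lemma triple_block_prog:
  "triple inp
     (\<lambda>s. ready d m s \<and> fst s 3 = i \<and> fst s 4 = i * m \<and> snd s 0 = T)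
     block_prog (6 + d * (6 + d * (12 + 13 * m)))
     (\<lambda>s. ready d m s \<and> fst s 3 = Suc i \<and> fst s 4 = Suc i * m \<and>
        snd s 0 = T + block_stat d m (m div 2) i inp)"
    (is "triple inp ?P _ _ ?Q")
proof -
  define J where "J = (\<lambda>k s. ready d m s \<and> fst s 3 = i \<and> fst s 4 = i * m \<and> fst s 5 = k
    \<and> snd s 0 = T + (\<Sum>a<k. \<Sum>b<a. half_sum (m div 2) (i * m) inp a b *
          half_sum (m div 2) (i * m + m div 2) inp a b))"
  have 1: "triple inp ?P (block [IConst 5 0]) 2 (J 0)"
    by (rule triple_block) (auto simp: J_def ready_def)
  have 2: "triple inp (J 0) (Loop (ILess 5 0) row_prog)
      (1 + d * (1 + (5 + d * (12 + 13 * m)))) (J d)"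
  proof (rule triple_Loop)
    show "holds (ILess 5 0) s \<longleftrightarrow> k < d" if "J k s" for k s
      using that by (cases s) (auto simp: J_def ready_def)
    show "triple inp (J k) row_prog (5 + d * (12 + 13 * m)) (J (Suc k))" if "k < d" for k
      by (rule triple_weaken[OF triple_row_prog[OF that, where i = i and
            T = "T + (\<Sum>a<k. \<Sum>b<a. half_sum (m div 2) (i * m) inp a b *
              half_sum (m div 2) (i * m + m div 2) inp a b)"]]) (auto simp: J_def)
  qed
  have 3: "triple inp (J d) (block [IAdd 3 3 10, IAdd 4 4 1]) 3 ?Q"
    by (rule triple_block) (auto simp: J_def ready_def block_stat_def)
  show ?thesis unfolding block_prog_def
    by (rule triple_weaken[OF triple_Seq[OF 1 triple_Seq[OF 2 3]]]) auto
qed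

lemma triple_decide_prog:
  "triple inp (\<lambda>s. ready d m s \<and> snd s 0 = stat d m inp) decide_prog 13
     (\<lambda>s. verdict s = spike_test d m inp)" (is "triple inp ?P _ _ ?Q")
proof -
  define J where "J = (\<lambda>s::state. snd s 0 = stat d m inp ^ 2 \<and>
    snd s 1 = real (m div 2) ^ 2 * real d ^ 3 * real (ceillog2 d))"
  have 1: "triple inp ?P (block [ROfI 1 2, ROfI 2 0, ROfI 3 11, RMul 1 1 1,
       RMul 4 2 2, RMul 4 4 2, RMul 1 1 4, RMul 1 1 3, RMul 0 0 0]) 10 J"
    by (rule triple_block) (auto simp: J_def ready_def power2_eq_square power3_eq_cube)
  have 2: "triple inp J (Cond (RLess 1 0) (block [IConst 0 1]) (block [IConst 0 0])) (1 + 2) ?Q"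
    by (intro triple_Cond triple_block) (auto simp: J_def verdict_def spike_test_def)
  show ?thesis unfolding decide_prog_def
    by (rule triple_weaken[OF triple_Seq[OF 1 2]]) auto
qed

lemma triple_test_prog:
  assumes "1 \<le> d" "1 \<le> m"
  shows "triple inp (\<lambda>s. s = initial d m) test_prog (100 * (d + m) ^ 4)
    (\<lambda>s. verdict s = spike_test d m inp)"
proof -
  define J where "J = (\<lambda>k s. ready d m s \<and> fst s 3 = k \<and> fst s 4 = k * m \<and>
    snd s 0 = (\<Sum>i<k. block_stat d m (m div 2) i inp))"
  let ?B = "6 + d * (6 + d * (12 + 13 * m))"
  have 2: "triple inp (J 0) (Loop (ILess 3 0) block_prog) (1 + d * (1 + ?B)) (J d)"
  proof (rule triple_Loop)
    show "holds (ILess 3 0) s \<longleftrightarrow> k < d" if "J k s" for k s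
      using that by (cases s) (auto simp: J_def ready_def)
    show "triple inp (J k) block_prog ?B (J (Suc k))" for k
      by (rule triple_weaken[OF triple_block_prog[where i = k and
            T = "\<Sum>i<k. block_stat d m (m div 2) i inp"]]) (auto simp: J_def)
  qed
  have "triple inp (\<lambda>s. s = initial d m) test_prog
      ((12 + 5 * m + 4 * d) + ((1 + d * (1 + ?B)) + 13)) (\<lambda>s. verdict s = spike_test d m inp)"
    unfolding test_prog_def
    by (intro triple_Seq[OF triple_weaken[OF triple_pre_prog[OF assms(1)]] triple_Seq[OF 2]]
        triple_weaken[OF triple_decide_prog]) (auto simp: J_def stat_def)
  moreover have "(12 + 5 * m + 4 * d) + ((1 + d * (1 + ?B)) + 13) \<le> 100 * (d + m) ^ 4"
  proof -
    define X where "X = d + m"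
    have X: "1 \<le> X" "d \<le> X" "m \<le> X" using assms by (auto simp: X_def)
    have p: "1 \<le> X ^ 4" "X \<le> X ^ 4" "X ^ 2 \<le> X ^ 4" "X ^ 3 \<le> X ^ 4"
      using X(1) power_increasing[of 1 4 X] power_increasing[of 2 4 X] power_increasing[of 3 4 X]
      by auto
    have "d * d \<le> X ^ 2" "d * (d * d) \<le> X ^ 3" "d * (d * (d * m)) \<le> X ^ 4"
      unfolding power2_eq_square power3_eq_cube power4_eq_xxxx mult.assoc
      using X by (auto intro!: mult_le_mono)
    \<comment> \<open>The coefficients add up to 73, and every monomial is at most
      \<open>X ^ 4\<close>.\<close>
    moreover have "(12 + 5 * m + 4 * d) + ((1 + d * (1 + ?B)) + 13) =
      26 + 5 * m + 11 * d + 6 * (d * d) + 12 * (d * (d * d)) + 13 * (d * (d * (d * m)))"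
      by (simp add: algebra_simps)
    ultimately show ?thesis using p X unfolding X_def[symmetric] by linarith
  qed
  ultimately show ?thesis unfolding triple_def by (meson le_trans)
qed

lemma poly_time_spike_test: "poly_time_test spike_test"
  unfolding poly_time_test_def
proof (rule exI[of _ test_prog], rule exI[of _ 100], rule exI[of _ 4], intro allI impI)
  fix d m :: nat and y :: "nat \<Rightarrow> nat \<Rightarrow> real"
  assume "1 \<le> d" "1 \<le> m"
  from triple_test_prog[OF this, of "input_array d m y"]
  obtain t s where *: "exec (input_array d m y) test_prog (initial d m) t s" "t \<le> 100 * (d + m) ^ 4"
    "verdict s = spike_test d m (input_array d m y)"
    unfolding triple_def by blast
  have "spike_test d m (input_array d m y) = spike_test d m y"
    by (simp add: spike_test_def stat_input_array)
  with * show "\<exists>t s. exec (input_array d m y) test_prog (initial d m) t s \<and>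
      t \<le> 100 * (d + m) ^ 4 \<and> spike_test d m y = verdict s"
    by (intro exI[of _ t] exI[of _ s]) simp
qed

section \<open>Gaussian moments\<close>

text \<open>The statistic has degree two in each sample and its square degree at most four, so the
  covariance and Wick's formula for four factors are all that the variance uses of a Gaussian law.
  In this form the property passes through linear maps without any densities.\<close>

definition gaussian_moments ::
    "nat \<Rightarrow> (nat \<Rightarrow> nat \<Rightarrow> real) \<Rightarrow> (nat \<Rightarrow> real) measure \<Rightarrow> bool" where
  "gaussian_moments d S N \<longleftrightarrow>
     prob_space N \<and> sets N = sets (PiM {..<d} (\<lambda>_. borel :: real measure)) \<and>
     (\<forall>a<d. \<forall>b<d. has_bochner_integral N (\<lambda>y. y a * y b) (S a b)) \<and>
     (\<forall>a<d. \<forall>b<d. \<forall>c<d. \<forall>e<d.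
        has_bochner_integral N (\<lambda>y. (y a * y b) * (y c * y e))
          (S a b * S c e + S a c * S b e + S a e * S b c))"

text \<open>For even \<open>k\<close> this is the double factorial (k - 1)!!.\<close>

definition std_moment :: "nat \<Rightarrow> real" where
  "std_moment k = (if even k then fact k / (2 ^ (k div 2) * fact (k div 2)) else 0)"

lemma std_moment_small [simp]:
  "std_moment 0 = 1" "std_moment (Suc 0) = 0" "std_moment (Suc (Suc 0)) = 1"
  "std_moment (Suc (Suc (Suc 0))) = 0" "std_moment (Suc (Suc (Suc (Suc 0)))) = 3"
  by (simp_all add: std_moment_def fact_numeral)

lemma has_bochner_integral_std_moment:
  "has_bochner_integral (density lborel std_normal_density) (\<lambda>x. x ^ k) (std_moment k)"
proof -
  have "has_bochner_integral lborel (\<lambda>x. std_normal_density x * x ^ k) (std_moment k)"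
  proof (cases "even k")
    case True
    then obtain j where "k = 2 * j" by (rule evenE)
    then show ?thesis using std_normal_moment_even[of j] by (simp add: std_moment_def)
  next
    case False
    then obtain j where "k = 2 * j + 1" by (rule oddE)
    then show ?thesis using std_normal_moment_odd[of j] by (simp add: std_moment_def)
  qed
  then show ?thesis by (intro has_bochner_integral_density) simp_all
qed

lemma prob_space_std_gaussian: "prob_space (std_gaussian d)"
  unfolding std_gaussian_def by (intro prob_space_PiM prob_space_normal_density) simp

lemma sets_std_gaussian [measurable_cong]: "sets (std_gaussian d) = sets (PiM {..<d} (\<lambda>_. borel))"
  unfolding std_gaussian_def by (intro sets_PiM_cong) auto

lemma has_bochner_integral_std_gaussian_monomial:
  "has_bochner_integral (std_gaussian d) (\<lambda>z. \<Prod>r<d. z r ^ e r) (\<Prod>r<d. std_moment (e r))"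
proof -
  interpret product_sigma_finite "\<lambda>_::nat. density lborel std_normal_density"
    by (intro product_sigma_finite.intro prob_space_imp_sigma_finite prob_space_normal_density) simp
  have int: "integrable (density lborel std_normal_density) (\<lambda>x. x ^ k)"
    and eq: "(\<integral>x. x ^ k \<partial>density lborel std_normal_density) = std_moment k" for k
    using has_bochner_integral_std_moment[of k] by (auto simp: has_bochner_integral_iff)
  show ?thesis unfolding has_bochner_integral_iff std_gaussian_def
    using product_integrable_prod[of "{..<d}" "\<lambda>r x. x ^ e r"]
      product_integral_prod[of "{..<d}" "\<lambda>r x. x ^ e r"] int eq by simp
qed

lemma prod_power_of_bool:
  fixes z :: "nat \<Rightarrow> real"
  assumes "a < d"
  shows "(\<Prod>r<d. z r ^ of_bool (r = a)) = z a"
proof -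
  have "(\<Prod>r<d. z r ^ of_bool (r = a)) = (\<Prod>r<d. if r = a then z r else 1)"
    by (rule prod.cong) auto
  then show ?thesis using assms by simp
qed

text \<open>A product of coordinates is written as a monomial whose exponent at \<open>r\<close>
  counts the occurrences of \<open>r\<close>; its expectation then factors into one-dimensional
  moments, which are 1 away from the occurring indices.\<close>

lemma gaussian_moments_std_gaussian: "gaussian_moments d (\<lambda>a b. of_bool (a = b)) (std_gaussian d)"
  unfolding gaussian_moments_def
proof (intro conjI allI impI)
  show "prob_space (std_gaussian d)" by (rule prob_space_std_gaussian)
  show "sets (std_gaussian d) = sets (PiM {..<d} (\<lambda>_. borel))" by (rule sets_std_gaussian)
next
  fix a b assume "a < d" "b < d"
  let ?e = "\<lambda>r. of_bool (r = a) + of_bool (r = b) :: nat"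
  have "(\<Prod>r<d. z r ^ ?e r) = z a * z b" for z :: "nat \<Rightarrow> real"
    using \<open>a < d\<close> \<open>b < d\<close> by (simp add: power_add prod.distrib prod_power_of_bool)
  moreover have "(\<Prod>r<d. std_moment (?e r)) = (\<Prod>r\<in>{a, b}. std_moment (?e r))"
    using \<open>a < d\<close> \<open>b < d\<close> by (intro prod.mono_neutral_right) auto
  moreover have "\<dots> = of_bool (a = b)" by (cases "a = b") auto
  ultimately show "has_bochner_integral (std_gaussian d) (\<lambda>y. y a * y b) (of_bool (a = b))"
    using has_bochner_integral_std_gaussian_monomial[of d ?e] by simp
next
  fix a b c e assume *: "a < d" "b < d" "c < d" "e < d"
  let ?e = "\<lambda>r. (of_bool (r = a) + of_bool (r = b)) + (of_bool (r = c) + of_bool (r = e)) :: nat"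
  let ?W = "of_bool (a = b) * of_bool (c = e) + of_bool (a = c) * of_bool (b = e) +
    of_bool (a = e) * of_bool (b = c) :: real"
  have "(\<Prod>r<d. z r ^ ?e r) = (z a * z b) * (z c * z e)" for z :: "nat \<Rightarrow> real"
    using * by (simp add: power_add prod.distrib prod_power_of_bool)
  moreover have "(\<Prod>r<d. std_moment (?e r)) = (\<Prod>r\<in>{a, b, c, e}. std_moment (?e r))"
    using * by (intro prod.mono_neutral_right) auto
  \<comment> \<open>Case distinction on which indices coincide: all four equal gives 3 = 1 + 1 + 1,
    two distinct pairs give 1, anything else contains an odd moment and gives 0.\<close>
  moreover have "\<dots> = ?W"
    by (cases "a = b"; cases "a = c"; cases "a = e"; cases "b = c"; cases "b = e"; cases "c = e")
      (simp_all add: insert_commute)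
  ultimately show "has_bochner_integral (std_gaussian d) (\<lambda>y. (y a * y b) * (y c * y e)) ?W"
    using has_bochner_integral_std_gaussian_monomial[of d ?e] by simp
qed

lemma mat_vec_measurable [measurable]:
  "mat_vec d A \<in> measurable (PiM {..<d} (\<lambda>_. borel)) (PiM {..<d} (\<lambda>_. borel))"
  unfolding mat_vec_def by measurable

text \<open>Both sides of each moment identity are multilinear in the coordinates, so expanding
  \<open>A z\<close> turns the identities for \<open>S\<close> into those for A S A^T.\<close>

lemma gaussian_moments_mat_vec:
  assumes N: "gaussian_moments d S N"
    and S': "\<And>a b. a < d \<Longrightarrow> b < d \<Longrightarrow> (\<Sum>k<d. \<Sum>l<d. A a k * A b l * S k l) = S' a b"
  shows "gaussian_moments d S' (distr N (PiM {..<d} (\<lambda>_. borel)) (mat_vec d A))"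
proof -
  let ?B = "PiM {..<d} (\<lambda>_. borel :: real measure)"
  have sets [measurable_cong]: "sets N = sets ?B" and "prob_space N"
    and N2: "\<And>a b. a < d \<Longrightarrow> b < d \<Longrightarrow> has_bochner_integral N (\<lambda>y. y a * y b) (S a b)"
    and N4: "\<And>a b c e. a < d \<Longrightarrow> b < d \<Longrightarrow> c < d \<Longrightarrow> e < d \<Longrightarrow>
        has_bochner_integral N (\<lambda>y. (y a * y b) * (y c * y e))
          (S a b * S c e + S a c * S b e + S a e * S b c)"
    using N by (auto simp: gaussian_moments_def)
  have meas: "mat_vec d A \<in> measurable N ?B" by measurable
  have distr: "has_bochner_integral (distr N ?B (mat_vec d A)) f r"
    if "f \<in> borel_measurable ?B" "has_bochner_integral N (\<lambda>z. f (mat_vec d A z)) r"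
    for f :: "(nat \<Rightarrow> real) \<Rightarrow> real" and r
    using that meas by (simp add: has_bochner_integral_iff integrable_distr_eq integral_distr)
  show ?thesis unfolding gaussian_moments_def
  proof (intro conjI allI impI)
    show "prob_space (distr N ?B (mat_vec d A))"
      using \<open>prob_space N\<close> meas by (rule prob_space.prob_space_distr)
    show "sets (distr N ?B (mat_vec d A)) = sets ?B" by simp
  next
    fix a b assume *: "a < d" "b < d"
    have "has_bochner_integral N (\<lambda>z. \<Sum>k<d. \<Sum>l<d. (A a k * A b l) * (z k * z l))
        (\<Sum>k<d. \<Sum>l<d. (A a k * A b l) * S k l)"
      by (intro has_bochner_integral_sum has_bochner_integral_mult_right N2) auto
    moreover have "(\<Sum>k<d. \<Sum>l<d. (A a k * A b l) * (z k * z l)) = mat_vec d A z a * mat_vec d A z b" for z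
      using * by (simp add: mat_vec_def sum_product mult_ac)
    ultimately have "has_bochner_integral N (\<lambda>z. mat_vec d A z a * mat_vec d A z b) (S' a b)"
      using S'[OF *] by simp
    then show "has_bochner_integral (distr N ?B (mat_vec d A)) (\<lambda>y. y a * y b) (S' a b)"
      using * by (intro distr) auto
  next
    fix a b c e assume *: "a < d" "b < d" "c < d" "e < d"
    let ?w = "\<lambda>k l p q. (A a k * A b l) * (A c p * A e q)"
    let ?T = "\<Sum>k<d. \<Sum>l<d. \<Sum>p<d. \<Sum>q<d. ?w k l p q * (S k l * S p q + S k p * S l q + S k q * S l p)"
    have "has_bochner_integral N
        (\<lambda>z. \<Sum>k<d. \<Sum>l<d. \<Sum>p<d. \<Sum>q<d. ?w k l p q * ((z k * z l) * (z p * z q))) ?T"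
      by (intro has_bochner_integral_sum has_bochner_integral_mult_right N4) auto
    moreover have "(\<Sum>k<d. \<Sum>l<d. \<Sum>p<d. \<Sum>q<d. ?w k l p q * ((z k * z l) * (z p * z q))) =
        (mat_vec d A z a * mat_vec d A z b) * (mat_vec d A z c * mat_vec d A z e)" for z
    proof -
      have "(mat_vec d A z a * mat_vec d A z b) * (mat_vec d A z c * mat_vec d A z e) =
        (\<Sum>k<d. \<Sum>l<d. (A a k * z k) * (A b l * z l)) * (\<Sum>p<d. \<Sum>q<d. (A c p * z p) * (A e q * z q))"
        using * by (simp add: mat_vec_def sum_product)
      also have "\<dots> = (\<Sum>k<d. \<Sum>l<d. \<Sum>p<d. \<Sum>q<d.
          ((A a k * z k) * (A b l * z l)) * ((A c p * z p) * (A e q * z q)))"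
        by (simp only: sum_distrib_right, simp only: sum_distrib_left)
      finally show ?thesis by (simp add: mult_ac)
    qed
    \<comment> \<open>Each of the three pairings is a product of two double sums. \<open>pr\<close>
      opens it with the paired indices adjacent; swapping or rotating the summations brings all
      three to the common order \<open>k\<close>, \<open>l\<close>, \<open>p\<close>,
      \<open>q\<close>.\<close>
    moreover have "?T = S' a b * S' c e + S' a c * S' b e + S' a e * S' b c"
    proof -
      let ?f = "\<lambda>a b k l. A a k * A b l * S k l"
      have pr: "S' a b * S' c e = (\<Sum>k<d. \<Sum>l<d. \<Sum>p<d. \<Sum>q<d. ?f a b k l * ?f c e p q)"
        if "a < d" "b < d" "c < d" "e < d" for a b c e
        unfolding S'[OF that(1,2), symmetric] S'[OF that(3,4), symmetric]
        by (simp only: sum_distrib_right, simp only: sum_distrib_left)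
      have "S' a c * S' b e = (\<Sum>k<d. \<Sum>l<d. \<Sum>p<d. \<Sum>q<d. ?f a c k p * ?f b e l q)"
        unfolding pr[OF *(1,3,2,4)] by (intro sum.cong refl sum.swap)
      moreover have "S' a e * S' b c = (\<Sum>k<d. \<Sum>l<d. \<Sum>p<d. \<Sum>q<d. ?f a e k q * ?f b c l p)"
      proof -
        have rot: "(\<Sum>q<d. \<Sum>l<d. \<Sum>p<d. h q l p) = (\<Sum>l<d. \<Sum>p<d. \<Sum>q<d. h q l p)"
          for h :: "nat \<Rightarrow> nat \<Rightarrow> nat \<Rightarrow> real"
          by (subst sum.swap) (intro sum.cong refl sum.swap)
        show ?thesis unfolding pr[OF *(1,4,2,3)] by (rule sum.cong[OF refl]) (rule rot)
      qed
      ultimately have "S' a b * S' c e + S' a c * S' b e + S' a e * S' b c =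
        (\<Sum>k<d. \<Sum>l<d. \<Sum>p<d. \<Sum>q<d. ?f a b k l * ?f c e p q + ?f a c k p * ?f b e l q + ?f a e k q * ?f b c l p)"
        unfolding pr[OF *] by (simp only: sum.distrib)
      also have "\<dots> = ?T" by (intro sum.cong refl) (simp add: algebra_simps)
      finally show ?thesis by simp
    qed
    ultimately have "has_bochner_integral N
       (\<lambda>z. (mat_vec d A z a * mat_vec d A z b) * (mat_vec d A z c * mat_vec d A z e))
       (S' a b * S' c e + S' a c * S' b e + S' a e * S' b c)" by simp
    then show "has_bochner_integral (distr N ?B (mat_vec d A)) (\<lambda>y. (y a * y b) * (y c * y e))
       (S' a b * S' c e + S' a c * S' b e + S' a e * S' b c)"
      using * by (intro distr) auto
  qed
qed

text \<open>The moments see the factor only through A A^T, which is exactly what \<open>SOME\<close>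
  guarantees.\<close>

lemma gaussian_moments_gaussian:
  assumes "\<exists>A. is_factor d A S"
  shows "gaussian_moments d S (gaussian d S)"
proof -
  have "is_factor d (SOME A. is_factor d A S) S" using assms by (rule someI_ex)
  then show ?thesis unfolding gaussian_def
    by (intro gaussian_moments_mat_vec[OF gaussian_moments_std_gaussian])
      (auto simp: is_factor_def of_bool_def if_distrib cong: if_cong)
qed

lemma prob_space_gaussian: "prob_space (gaussian d S)"
  unfolding gaussian_def
  by (intro prob_space.prob_space_distr prob_space_std_gaussian) measurable

lemma sets_gaussian: "sets (gaussian d S) = sets (PiM {..<d} (\<lambda>_. borel))"
  by (simp add: gaussian_def)

section \<open>Mean and variance of the statistic\<close>

text \<open>The coordinates of a product measure are independent, hence so are functions of disjoint
  groups of coordinates. The \<open>restrict\<close> conditions say that \<open>f\<close> and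
  \<open>g\<close> factor through their groups.\<close>

lemma has_bochner_integral_PiM_mult:
  fixes f g :: "('i \<Rightarrow> 'a) \<Rightarrow> real"
  assumes N: "\<And>j. j \<in> J \<Longrightarrow> prob_space (N j)" and "J \<noteq> {}"
    and KL: "K \<inter> L = {}" "K \<subseteq> J" "L \<subseteq> J"
    and f: "f \<in> borel_measurable (PiM K N)" "\<And>y. f (restrict y K) = f y"
    and g: "g \<in> borel_measurable (PiM L N)" "\<And>y. g (restrict y L) = g y"
    and int: "has_bochner_integral (PiM J N) f r" "has_bochner_integral (PiM J N) g s"
  shows "has_bochner_integral (PiM J N) (\<lambda>y. f y * g y) (r * s)"
proof -
  interpret prob_space "PiM J N" using N by (rule prob_space_PiM)
  \<comment> \<open>Independence is checked by comparing the joint law of the coordinates with the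
    product of their marginals; the joint map is the identity on the space.\<close>
  have "distr (PiM J N) (PiM J N) (\<lambda>y. restrict y J) = distr (PiM J N) (PiM J N) (\<lambda>y. y)"
    by (rule distr_cong) (auto simp: space_PiM)
  also have "\<dots> = PiM J (\<lambda>j. distr (PiM J N) (N j) (\<lambda>y. y j))"
    unfolding distr_id by (rule PiM_cong[OF refl]) (simp add: distr_PiM_component N)
  finally have "indep_vars N (\<lambda>j y. y j) J"
    using \<open>J \<noteq> {}\<close> by (subst indep_vars_iff_distr_eq_PiM') auto
  from indep_var_compose[OF indep_var_restrict[OF this KL] f(1) g(1)]
  have "indep_var borel f borel g" by (simp add: comp_def f(2) g(2))
  then show ?thesis
    using indep_var_lebesgue_integral[of f g] indep_var_integrable[of f g] int
    by (simp add: has_bochner_integral_iff)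
qed

section \<open>Independent blocks with arbitrary Gaussian covariances\<close>

definition off_pairs :: "nat \<Rightarrow> (nat \<times> nat) set" where
  "off_pairs d = (SIGMA a:{..<d}. {..<a})"

text \<open>Once x and s are fixed, both hypotheses are instances: identity covariance in every
  block, or one spiked covariance per block. Mean and variance are thus computed once for
  both.\<close>

locale block_model =
  fixes d m n :: nat and S :: "nat \<Rightarrow> nat \<Rightarrow> nat \<Rightarrow> real" and N :: "nat \<Rightarrow> (nat \<Rightarrow> real) measure"
  assumes d_pos: "1 \<le> d" and m_pos: "1 \<le> m" and n_le: "2 * n \<le> m"
    and moments: "\<And>i. i < d \<Longrightarrow> gaussian_moments d (S i) (N i)"
begin

definition M :: "(nat \<Rightarrow> nat \<Rightarrow> real) measure" where
  "M = PiM {..<m * d} (\<lambda>j. N (j div m))"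

lemma block_lt: "j < m * d \<Longrightarrow> j div m < d"
  using m_pos by (simp add: less_mult_imp_div_less mult.commute)

lemma block_bound: "i < d \<Longrightarrow> j < m \<Longrightarrow> i * m + j < m * d"
proof -
  assume "i < d" "j < m"
  then have "i * m + j < Suc i * m" by simp
  also have "\<dots> \<le> d * m" using \<open>i < d\<close> by (intro mult_le_mono1) simp
  finally show ?thesis by (simp add: mult.commute)
qed

lemma block_index: "j < m \<Longrightarrow> (i * m + j) div m = i"
  by simp

lemma prob_N: "j < m * d \<Longrightarrow> prob_space (N (j div m))"
  and sets_N: "j < m * d \<Longrightarrow> sets (N (j div m)) = sets (PiM {..<d} (\<lambda>_. borel))"
  using moments[OF block_lt] by (auto simp: gaussian_moments_def)

definition depends_on :: "nat set \<Rightarrow> ((nat \<Rightarrow> nat \<Rightarrow> real) \<Rightarrow> real) \<Rightarrow> bool" where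
  "depends_on K f \<longleftrightarrow> K \<subseteq> {..<m * d} \<and> f \<in> borel_measurable (PiM K (\<lambda>j. N (j div m))) \<and>
     (\<forall>y. f (restrict y K) = f y)"

lemma has_bochner_integral_mult_indep:
  assumes "depends_on K f" "depends_on L g" "K \<inter> L = {}"
    "has_bochner_integral M f r" "has_bochner_integral M g s"
  shows "has_bochner_integral M (\<lambda>y. f y * g y) (r * s)"
proof -
  have "0 \<in> {..<m * d}" using d_pos m_pos by simp
  then have "{..<m * d} \<noteq> {}" by blast
  then show ?thesis
    using assms prob_N unfolding M_def depends_on_def
    by (intro has_bochner_integral_PiM_mult[of "{..<m * d}" _ K L]) auto
qed

lemma depends_on_coord:
  assumes "j \<in> K" "a < d" "K \<subseteq> {..<m * d}"
  shows "depends_on K (\<lambda>y. y j a)"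
proof -
  have "(\<lambda>y. y a) \<in> borel_measurable (N (j div m))"
    using assms sets_N[of j] by (subst measurable_cong_sets[OF _ refl]) auto
  then have "(\<lambda>y. y j a) \<in> borel_measurable (PiM K (\<lambda>j. N (j div m)))"
    using assms(1) by (rule measurable_compose[OF measurable_component_singleton, rotated])
  then show ?thesis using assms by (simp add: depends_on_def)
qed

lemma depends_on_mult: "depends_on K f \<Longrightarrow> depends_on K g \<Longrightarrow> depends_on K (\<lambda>y. f y * g y)"
  by (auto simp: depends_on_def)

lemma depends_on_sum:
  "K \<subseteq> {..<m * d} \<Longrightarrow> (\<And>i. i \<in> I \<Longrightarrow> depends_on K (f i)) \<Longrightarrow> depends_on K (\<lambda>y. \<Sum>i\<in>I. f i y)"
  by (auto simp: depends_on_def intro!: borel_measurable_sum)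

text \<open>Covariance, for one sample of block \<open>i\<close>, of the coordinate products indexed
  by \<open>p\<close> and \<open>q\<close>: Wick's formula without the pairing that yields the
  product of the means.\<close>

definition cov :: "nat \<Rightarrow> nat \<times> nat \<Rightarrow> nat \<times> nat \<Rightarrow> real" where
  "cov i p q = S i (fst p) (fst q) * S i (snd p) (snd q) + S i (fst p) (snd q) * S i (snd p) (fst q)"

definition mean :: "nat \<Rightarrow> nat \<times> nat \<Rightarrow> real" where
  "mean i p = S i (fst p) (snd p)"

definition half :: "nat \<Rightarrow> nat \<times> nat \<Rightarrow> (nat \<Rightarrow> nat \<Rightarrow> real) \<Rightarrow> real" where
  "half u p y = half_sum n u y (fst p) (snd p)"

lemma off_pairsD: "p \<in> off_pairs d \<Longrightarrow> fst p < d \<and> snd p < d"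
  by (auto simp: off_pairs_def)

lemma finite_off_pairs [simp]: "finite (off_pairs d)"
  by (simp add: off_pairs_def)

lemma has_bochner_integral_coord:
  assumes "j < m * d" "j div m = i" "p \<in> off_pairs d" "q \<in> off_pairs d"
  shows "has_bochner_integral M (\<lambda>y. y j (fst p) * y j (snd p)) (mean i p)"
    and "has_bochner_integral M (\<lambda>y. (y j (fst p) * y j (snd p)) * (y j (fst q) * y j (snd q)))
      (mean i p * mean i q + cov i p q)"
proof -
  have meas: "(\<lambda>y. y j) \<in> measurable M (N i)"
    using assms(1,2) by (auto simp: M_def)
  have distr: "distr M (N i) (\<lambda>y. y j) = N i"
    using distr_PiM_component[of "{..<m * d}" "\<lambda>j. N (j div m)" j] prob_N assms(1,2)
    by (simp add: M_def)
  have coord: "has_bochner_integral M (\<lambda>y. f (y j)) r" if "has_bochner_integral (N i) f r"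
    for f :: "(nat \<Rightarrow> real) \<Rightarrow> real" and r
  proof -
    have f: "f \<in> borel_measurable (N i)" using that by (auto elim: has_bochner_integral.cases)
    have "has_bochner_integral (distr M (N i) (\<lambda>y. y j)) f r" using that by (simp add: distr)
    then show ?thesis using f meas
      by (simp add: has_bochner_integral_iff integrable_distr_eq integral_distr)
  qed
  have "gaussian_moments d (S i) (N i)" using moments[OF block_lt] assms(1,2) by blast
  moreover have "fst p < d" "snd p < d" "fst q < d" "snd q < d"
    using assms(3,4)[THEN off_pairsD] by auto
  ultimately show "has_bochner_integral M (\<lambda>y. y j (fst p) * y j (snd p)) (mean i p)"
    "has_bochner_integral M (\<lambda>y. (y j (fst p) * y j (snd p)) * (y j (fst q) * y j (snd q)))
      (mean i p * mean i q + cov i p q)"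
    unfolding gaussian_moments_def mean_def cov_def add.assoc[symmetric]
    by (auto intro!: coord)
qed

text \<open>Leaves open which half starts at \<open>u\<close>, so that one computation serves both
  halves.\<close>

definition in_block :: "nat \<Rightarrow> nat \<Rightarrow> bool" where
  "in_block i u \<longleftrightarrow> (\<forall>j<n. u + j < m * d \<and> (u + j) div m = i)"

lemma in_block_halves: "i < d \<Longrightarrow> in_block i (i * m)" "i < d \<Longrightarrow> in_block i (i * m + n)"
proof -
  assume i: "i < d"
  have "i * m + j < m * d \<and> (i * m + j) div m = i" if "j < m" for j
    using block_bound[OF i that] block_index[OF that] by simp
  then show "in_block i (i * m)" "in_block i (i * m + n)"
    using n_le by (auto simp: in_block_def add.assoc)
qed

lemma depends_on_half:
  assumes "in_block i u" "p \<in> off_pairs d"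
  shows "depends_on {u..<u + n} (half u p)"
proof -
  have sub: "{u..<u + n} \<subseteq> {..<m * d}"
    using assms(1) by (auto simp: in_block_def) (metis add_diff_inverse_nat add_less_cancel_left leD)
  show ?thesis unfolding half_def half_sum_def
    using off_pairsD[OF assms(2)] sub
    by (intro depends_on_sum depends_on_mult depends_on_coord) auto
qed

lemma has_bochner_integral_half:
  assumes u: "in_block i u" and p: "p \<in> off_pairs d"
  shows "has_bochner_integral M (half u p) (real n * mean i p)"
proof -
  have "has_bochner_integral M (\<lambda>y. \<Sum>j<n. y (u + j) (fst p) * y (u + j) (snd p)) (\<Sum>j<n. mean i p)"
    using u p by (intro has_bochner_integral_sum has_bochner_integral_coord(1)) (auto simp: in_block_def)
  then show ?thesis by (simp add: half_def[abs_def] half_sum_def)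
qed

text \<open>All n^2 pairs of samples contribute the product of the means; the n pairs of a sample
  with itself contribute the covariance on top.\<close>

lemma has_bochner_integral_half_mult:
  assumes u: "in_block i u" and p: "p \<in> off_pairs d" and q: "q \<in> off_pairs d"
  shows "has_bochner_integral M (\<lambda>y. half u p y * half u q y)
    (real n ^ 2 * (mean i p * mean i q) + real n * cov i p q)"
proof -
  let ?w = "\<lambda>j p y. y (u + j) (fst p) * y (u + j) (snd p) :: real"
  have "has_bochner_integral M (\<lambda>y. ?w j p y * ?w k q y)
      (mean i p * mean i q + (if j = k then cov i p q else 0))" if "j < n" "k < n" for j k
  proof (cases "j = k")
    case True
    then show ?thesis using u that p q
      by (auto simp: in_block_def intro!: has_bochner_integral_coord(2))
  next
    case False
    have "depends_on {u + j} (?w j p)" if "j < n" "p \<in> off_pairs d" for j p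
      using off_pairsD[OF that(2)] u that(1)
      by (intro depends_on_mult depends_on_coord) (auto simp: in_block_def)
    then have "has_bochner_integral M (\<lambda>y. ?w j p y * ?w k q y) (mean i p * mean i q)"
      using u p q that False
      by (intro has_bochner_integral_mult_indep[of "{u + j}" _ "{u + k}"]
          has_bochner_integral_coord(1)) (auto simp: in_block_def)
    then show ?thesis using False by simp
  qed
  then have "has_bochner_integral M (\<lambda>y. \<Sum>j<n. \<Sum>k<n. ?w j p y * ?w k q y)
      (\<Sum>j<n. \<Sum>k<n. mean i p * mean i q + (if j = k then cov i p q else 0))"
    by (intro has_bochner_integral_sum) auto
  moreover have "(\<Sum>j<n. \<Sum>k<n. mean i p * mean i q + (if j = k then cov i p q else 0)) =
      real n ^ 2 * (mean i p * mean i q) + real n * cov i p q"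
    by (simp add: sum.distrib power2_eq_square algebra_simps)
  ultimately show ?thesis by (simp add: half_def half_sum_def sum_product)
qed

lemma block_stat_eq:
  "block_stat d m n i y = (\<Sum>p\<in>off_pairs d. half (i * m) p y * half (i * m + n) p y)"
  unfolding block_stat_def half_def off_pairs_def
  by (subst sum.Sigma) (auto simp: case_prod_beta)

lemma depends_on_block_stat:
  assumes "i < d"
  shows "depends_on {i * m..<i * m + m} (block_stat d m n i)"
proof -
  have sub: "{i * m..<i * m + m} \<subseteq> {..<m * d}"
  proof
    fix j assume "j \<in> {i * m..<i * m + m}"
    then show "j \<in> {..<m * d}" using block_bound[OF assms, of "j - i * m"] by auto
  qed
  have "depends_on {i * m..<i * m + m} (\<lambda>y. \<Sum>a<d. \<Sum>b<a.
      (\<Sum>j<n. y (i * m + j) a * y (i * m + j) b) *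
      (\<Sum>j<n. y (i * m + n + j) a * y (i * m + n + j) b))"
    using sub n_le by (intro depends_on_sum depends_on_mult depends_on_coord) auto
  then show ?thesis by (simp add: block_stat_def[abs_def] half_sum_def)
qed

text \<open>The two halves are independent and have the same moments, so each expectation is the
  square of the corresponding expectation for one half.\<close>

lemma has_bochner_integral_block_stat:
  assumes "i < d"
  shows "has_bochner_integral M (block_stat d m n i) (\<Sum>p\<in>off_pairs d. (real n * mean i p)\<^sup>2)"
    and "has_bochner_integral M (\<lambda>y. block_stat d m n i y * block_stat d m n i y)
      (\<Sum>p\<in>off_pairs d. \<Sum>q\<in>off_pairs d.
         (real n ^ 2 * (mean i p * mean i q) + real n * cov i p q)\<^sup>2)"
proof -
  note u = in_block_halves[OF assms]
  let ?A = "{i * m..<i * m + n}" and ?B = "{i * m + n..<i * m + n + n}"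
  have disj: "?A \<inter> ?B = {}" by auto
  have "has_bochner_integral M (\<lambda>y. half (i * m) p y * half (i * m + n) p y) ((real n * mean i p)\<^sup>2)"
    if "p \<in> off_pairs d" for p
    unfolding power2_eq_square
    by (intro has_bochner_integral_mult_indep[OF depends_on_half[OF u(1)] depends_on_half[OF u(2)] disj]
        has_bochner_integral_half u that)
  then show "has_bochner_integral M (block_stat d m n i) (\<Sum>p\<in>off_pairs d. (real n * mean i p)\<^sup>2)"
    unfolding block_stat_eq[abs_def] by (rule has_bochner_integral_sum)
  have "has_bochner_integral M (\<lambda>y. (half (i * m) p y * half (i * m) q y) *
      (half (i * m + n) p y * half (i * m + n) q y))
      ((real n ^ 2 * (mean i p * mean i q) + real n * cov i p q)\<^sup>2)"
    if "p \<in> off_pairs d" "q \<in> off_pairs d" for p q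
    unfolding power2_eq_square[of "real n ^ 2 * (mean i p * mean i q) + real n * cov i p q"]
    by (intro has_bochner_integral_mult_indep[OF depends_on_mult[OF depends_on_half depends_on_half,
            OF u(1) _ u(1)] depends_on_mult[OF depends_on_half depends_on_half, OF u(2) _ u(2)] disj]
        has_bochner_integral_half_mult u that)
  then have "has_bochner_integral M (\<lambda>y. \<Sum>p\<in>off_pairs d. \<Sum>q\<in>off_pairs d.
      (half (i * m) p y * half (i * m) q y) * (half (i * m + n) p y * half (i * m + n) q y))
      (\<Sum>p\<in>off_pairs d. \<Sum>q\<in>off_pairs d.
         (real n ^ 2 * (mean i p * mean i q) + real n * cov i p q)\<^sup>2)"
    by (intro has_bochner_integral_sum) auto
  then show "has_bochner_integral M (\<lambda>y. block_stat d m n i y * block_stat d m n i y)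
      (\<Sum>p\<in>off_pairs d. \<Sum>q\<in>off_pairs d.
         (real n ^ 2 * (mean i p * mean i q) + real n * cov i p q)\<^sup>2)"
    by (simp add: block_stat_eq sum_product mult_ac)
qed

definition total :: "(nat \<Rightarrow> nat \<Rightarrow> real) \<Rightarrow> real" where
  "total y = (\<Sum>i<d. block_stat d m n i y)"

definition block_mean :: "nat \<Rightarrow> real" where
  "block_mean i = (\<Sum>p\<in>off_pairs d. (real n * mean i p)\<^sup>2)"

text \<open>The summand is (n^2 u + n v)^2 - (n^2 u)^2, with u the product of the means and v the
  covariance.\<close>

definition block_var :: "nat \<Rightarrow> real" where
  "block_var i = (\<Sum>p\<in>off_pairs d. \<Sum>q\<in>off_pairs d.
     real n ^ 2 * (cov i p q)\<^sup>2 + 2 * real n ^ 3 * (cov i p q * (mean i p * mean i q)))"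

lemma has_bochner_integral_total: "has_bochner_integral M total (\<Sum>i<d. block_mean i)"
  unfolding total_def[abs_def] block_mean_def
  by (intro has_bochner_integral_sum has_bochner_integral_block_stat(1)) simp

text \<open>Distinct blocks use disjoint samples, so their cross terms are products of means and the
  variances add up.\<close>

lemma has_bochner_integral_total_square:
  "has_bochner_integral M (\<lambda>y. (total y)\<^sup>2) ((\<Sum>i<d. block_mean i)\<^sup>2 + (\<Sum>i<d. block_var i))"
proof -
  let ?T = "block_stat d m n"
  have "has_bochner_integral M (\<lambda>y. ?T i y * ?T k y)
      (block_mean i * block_mean k + (if i = k then block_var i else 0))" if "i < d" "k < d" for i k
  proof (cases "i = k")
    case True
    have "(\<Sum>p\<in>off_pairs d. \<Sum>q\<in>off_pairs d.
        (real n ^ 2 * (mean i p * mean i q) + real n * cov i p q)\<^sup>2) =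
      block_mean i * block_mean i + block_var i"
      unfolding block_mean_def block_var_def sum_product sum.distrib[symmetric]
      by (intro sum.cong refl) (simp add: power2_eq_square power3_eq_cube algebra_simps)
    then show ?thesis using has_bochner_integral_block_stat(2)[OF that(1)] True by simp
  next
    case False
    have "{i * m..<i * m + m} \<inter> {k * m..<k * m + m} = {}"
    proof -
      have "j div m = i" if "j \<in> {i * m..<i * m + m}" for i j
        using that block_index[of "j - i * m" i] by auto
      then show ?thesis using False by blast
    qed
    from has_bochner_integral_mult_indep[OF depends_on_block_stat[OF that(1)]
        depends_on_block_stat[OF that(2)] this has_bochner_integral_block_stat(1)[OF that(1)]
        has_bochner_integral_block_stat(1)[OF that(2)]]
    show ?thesis using False by (simp add: block_mean_def)
  qed
  then have "has_bochner_integral M (\<lambda>y. \<Sum>i<d. \<Sum>k<d. ?T i y * ?T k y)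
      (\<Sum>i<d. \<Sum>k<d. block_mean i * block_mean k + (if i = k then block_var i else 0))"
    by (intro has_bochner_integral_sum) auto
  moreover have "(\<Sum>i<d. \<Sum>k<d. block_mean i * block_mean k + (if i = k then block_var i else 0)) =
      (\<Sum>i<d. block_mean i)\<^sup>2 + (\<Sum>i<d. block_var i)"
    by (simp add: sum.distrib power2_eq_square sum_product)
  ultimately show ?thesis by (simp add: total_def power2_eq_square sum_product)
qed

lemma prob_space_M: "prob_space M"
  unfolding M_def using prob_N by (intro prob_space_PiM) auto

lemma sets_M: "sets M = sets (PiM {..<m * d} (\<lambda>_. PiM {..<d} (\<lambda>_. borel)))"
  unfolding M_def using sets_N by (intro sets_PiM_cong) auto

lemma variance_total:
  "(\<integral>y. (total y - (\<Sum>i<d. block_mean i))\<^sup>2 \<partial>M) = (\<Sum>i<d. block_var i)"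
proof -
  interpret prob_space M by (rule prob_space_M)
  show ?thesis
    using variance_eq[of total] has_bochner_integral_total has_bochner_integral_total_square
    by (simp add: has_bochner_integral_iff)
qed

end

section \<open>Spiked covariances: bounds uniform in the spike and the signs\<close>

lemma card_off_pairs: "real (card (off_pairs d)) = real d * (real d - 1) / 2"
proof -
  have "card (off_pairs d) = (\<Sum>a<d. a)" by (simp add: off_pairs_def)
  moreover have "2 * real (\<Sum>a<d. a) = real d * (real d - 1)"
    by (induction d) (auto simp: algebra_simps)
  ultimately show ?thesis by simp
qed

context block_model
begin

lemma spike_entries:
  assumes x: "\<And>a. a < d \<Longrightarrow> (x a)\<^sup>2 = 1 / real d" and "a < d" "b < d"
  shows "\<bar>x a * x b\<bar> = 1 / real d"
proof (rule power2_eq_imp_eq)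
  show "\<bar>x a * x b\<bar>\<^sup>2 = (1 / real d)\<^sup>2"
    using x[OF \<open>a < d\<close>] x[OF \<open>b < d\<close>] by (simp add: power_mult_distrib power2_eq_square[of "1 / real d"])
qed auto

lemma mean_spiked:
  assumes x: "\<And>a. a < d \<Longrightarrow> (x a)\<^sup>2 = 1 / real d" and S: "S i = spiked_cov c x"
    and p: "p \<in> off_pairs d"
  shows "\<bar>mean i p\<bar> = \<bar>c\<bar> / real d"
proof -
  have "fst p \<noteq> snd p" "fst p < d" "snd p < d" using p by (auto simp: off_pairs_def)
  then have "mean i p = c * (x (fst p) * x (snd p))" by (simp add: mean_def S spiked_cov_def)
  then show ?thesis
    using spike_entries[where x = x, OF x \<open>fst p < d\<close> \<open>snd p < d\<close>] by (simp add: abs_mult)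
qed

lemma block_mean_spiked:
  assumes x: "\<And>a. a < d \<Longrightarrow> (x a)\<^sup>2 = 1 / real d" and S: "S i = spiked_cov c x"
  shows "block_mean i = real n ^ 2 * c\<^sup>2 * (real d - 1) / (2 * real d)"
proof -
  have "(real n * mean i p)\<^sup>2 = real n ^ 2 * c\<^sup>2 / real d ^ 2" if "p \<in> off_pairs d" for p
  proof -
    have "(mean i p)\<^sup>2 = (\<bar>c\<bar> / real d)\<^sup>2" using mean_spiked[where x = x, OF x S that] by (metis power2_abs)
    then show ?thesis by (simp add: power_mult_distrib power_divide)
  qed
  then have "block_mean i = real (card (off_pairs d)) * (real n ^ 2 * c\<^sup>2 / real d ^ 2)"
    by (simp add: block_mean_def)
  moreover have "real d * (real d - 1) / 2 * (r / real d ^ 2) = r * (real d - 1) / (2 * real d)" for r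
    using d_pos by (simp add: power2_eq_square field_simps)
  ultimately show ?thesis by (simp only: card_off_pairs)
qed

text \<open>Over all quadruples the sums factor, over pairs with \<open>b < a\<close> they do not;
  nonnegativity pays for the extra terms.\<close>

lemma sum_off_pairs_le:
  assumes "\<And>a b c e. a < d \<Longrightarrow> b < d \<Longrightarrow> c < d \<Longrightarrow> e < d \<Longrightarrow> 0 \<le> F a b c e"
  shows "(\<Sum>p\<in>off_pairs d. \<Sum>q\<in>off_pairs d. F (fst p) (snd p) (fst q) (snd q)) \<le>
    (\<Sum>a<d. \<Sum>b<d. \<Sum>c<d. \<Sum>e<d. F a b c e :: real)"
proof -
  let ?D = "{..<d} \<times> {..<d}"
  have sub: "off_pairs d \<subseteq> ?D" using off_pairsD by (auto simp: subset_iff)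
  have "(\<Sum>p\<in>off_pairs d. \<Sum>q\<in>off_pairs d. F (fst p) (snd p) (fst q) (snd q)) \<le>
    (\<Sum>p\<in>off_pairs d. \<Sum>q\<in>?D. F (fst p) (snd p) (fst q) (snd q))"
    by (intro sum_mono sum_mono2 sub) (auto intro!: assms dest: off_pairsD)
  also have "\<dots> \<le> (\<Sum>p\<in>?D. \<Sum>q\<in>?D. F (fst p) (snd p) (fst q) (snd q))"
    by (intro sum_mono2 sub sum_nonneg) (auto intro!: assms)
  also have "\<dots> = (\<Sum>a<d. \<Sum>b<d. \<Sum>c<d. \<Sum>e<d. F a b c e)"
  proof -
    have "(\<Sum>p\<in>?D. f p) = (\<Sum>a<d. \<Sum>b<d. f (a, b))" for f :: "nat \<times> nat \<Rightarrow> real"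
      by (simp add: sum.cartesian_product)
    then show ?thesis by simp
  qed
  finally show ?thesis .
qed

text \<open>Either pairing of \<open>a\<close>, \<open>b\<close> with \<open>c\<close>,
  \<open>e\<close> sums to the same square.\<close>

lemma sum_wick_products:
  fixes h :: "nat \<Rightarrow> nat \<Rightarrow> real"
  shows "(\<Sum>a<d. \<Sum>b<d. \<Sum>c<d. \<Sum>e<d. h a c * h b e + h a e * h b c) = 2 * (\<Sum>a<d. \<Sum>c<d. h a c)\<^sup>2"
proof -
  have sq: "(\<Sum>a<d. \<Sum>c<d. h a c)\<^sup>2 = (\<Sum>a<d. \<Sum>b<d. \<Sum>c<d. \<Sum>e<d. h a c * h b e)"
    unfolding power2_eq_square sum_product ..
  moreover have "(\<Sum>c<d. \<Sum>e<d. h a e * h b c) = (\<Sum>c<d. \<Sum>e<d. h a c * h b e)" for a b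
    by (rule sum.swap)
  ultimately show ?thesis by (simp add: sum.distrib sum_distrib_left)
qed

text \<open>The entries of a spiked covariance are at most 1/d off the diagonal and at most 1 + 1/d
  on it, so both the absolute values and the squares of all d^2 entries sum to O(d). Wick's formula
  turns this into O(d^2) for the sums of |cov| and of cov^2 over pairs of pairs.\<close>

lemma block_var_spiked_le:
  assumes x: "\<And>a. a < d \<Longrightarrow> (x a)\<^sup>2 = 1 / real d" and S: "S i = spiked_cov c x"
    and c: "\<bar>c\<bar> \<le> 1"
  shows "block_var i \<le> 64 * real n ^ 2 * real d ^ 2 + 16 * real n ^ 3 * c\<^sup>2"
proof -
  define h where "h = S i"
  define \<epsilon> where "\<epsilon> = 1 / real d"
  have eps: "0 \<le> \<epsilon>" "\<epsilon> \<le> 1" "real d * \<epsilon> = 1" using d_pos by (auto simp: \<epsilon>_def)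
  have h: "\<bar>h a b\<bar> \<le> (if a = b then 1 else 0) + \<epsilon>" if "a < d" "b < d" for a b
  proof -
    have "\<bar>x a * x b\<bar> = 1 / real d" using x that by (rule spike_entries)
    then have "\<bar>c * (x a * x b)\<bar> \<le> 1 * (1 / real d)"
      unfolding abs_mult[of c] using c by (simp only:) (intro mult_right_mono, auto)
    then show ?thesis by (auto simp: h_def S spiked_cov_def \<epsilon>_def abs_le_iff mult.assoc)
  qed
  \<comment> \<open>On the diagonal (1 + \<epsilon>)^2 \<le> 3 + \<epsilon>^2 as \<epsilon> \<le> 1.
    The terms \<epsilon>^2 over all d^2 entries sum to just 1.\<close>
  have h2: "(h a b)\<^sup>2 \<le> (if a = b then 3 else 0) + \<epsilon>\<^sup>2" if "a < d" "b < d" for a b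
  proof -
    have "(h a b)\<^sup>2 \<le> ((if a = b then 1 else 0) + \<epsilon>)\<^sup>2"
      using h[OF that] by (intro abs_le_square_iff[THEN iffD1]) auto
    also have "\<dots> \<le> (if a = b then 3 else 0) + \<epsilon>\<^sup>2"
      using eps by (auto simp: power2_eq_square algebra_simps)
    finally show ?thesis .
  qed
  have sum_h: "(\<Sum>a<d. \<Sum>b<d. \<bar>h a b\<bar>) \<le> 2 * real d"
  proof -
    have "(\<Sum>a<d. \<Sum>b<d. \<bar>h a b\<bar>) \<le> (\<Sum>a<d. \<Sum>b<d. (if a = b then 1 else 0) + \<epsilon>)"
      using h by (intro sum_mono) auto
    also have "\<dots> = real d + real d * (real d * \<epsilon>)"
      by (simp add: sum.distrib algebra_simps)
    finally show ?thesis using eps by simp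
  qed
  have sum_h2: "(\<Sum>a<d. \<Sum>b<d. (h a b)\<^sup>2) \<le> 4 * real d"
  proof -
    have "(\<Sum>a<d. \<Sum>b<d. (h a b)\<^sup>2) \<le> (\<Sum>a<d. \<Sum>b<d. (if a = b then 3 else 0) + \<epsilon>\<^sup>2)"
      using h2 by (intro sum_mono) auto
    also have "\<dots> = 3 * real d + (real d * \<epsilon>)\<^sup>2"
      by (simp add: sum.distrib power2_eq_square algebra_simps)
    finally show ?thesis using eps d_pos by simp
  qed
  have cov: "cov i p q = h (fst p) (fst q) * h (snd p) (snd q) + h (fst p) (snd q) * h (snd p) (fst q)"
    for p q by (simp add: cov_def h_def)
  have "(\<Sum>p\<in>off_pairs d. \<Sum>q\<in>off_pairs d. (cov i p q)\<^sup>2) \<le> (\<Sum>p\<in>off_pairs d. \<Sum>q\<in>off_pairs d.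
      2 * ((h (fst p) (fst q))\<^sup>2 * (h (snd p) (snd q))\<^sup>2 + (h (fst p) (snd q))\<^sup>2 * (h (snd p) (fst q))\<^sup>2))"
  proof (intro sum_mono)
    \<comment> \<open>2 (u^2 + v^2) - (u + v)^2 = (u - v)^2, for u and v the two Wick
      products.\<close>
    show "(cov i p q)\<^sup>2 \<le> 2 * ((h (fst p) (fst q))\<^sup>2 * (h (snd p) (snd q))\<^sup>2 +
        (h (fst p) (snd q))\<^sup>2 * (h (snd p) (fst q))\<^sup>2)" for p q
      using sum_squares_ge_zero[of "h (fst p) (fst q) * h (snd p) (snd q) - h (fst p) (snd q) * h (snd p) (fst q)" 0]
      unfolding cov by (simp add: power2_eq_square algebra_simps)
  qed
  also have "\<dots> \<le> (\<Sum>a<d. \<Sum>b<d. \<Sum>c<d. \<Sum>e<d.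
      2 * ((h a c)\<^sup>2 * (h b e)\<^sup>2 + (h a e)\<^sup>2 * (h b c)\<^sup>2))"
    by (rule sum_off_pairs_le[where
          F = "\<lambda>a b c e. 2 * ((h a c)\<^sup>2 * (h b e)\<^sup>2 + (h a e)\<^sup>2 * (h b c)\<^sup>2)"]) simp
  also have "\<dots> = 4 * (\<Sum>a<d. \<Sum>c<d. (h a c)\<^sup>2)\<^sup>2"
    using sum_wick_products[of "\<lambda>a b. (h a b)\<^sup>2"] by (simp only: sum_distrib_left[symmetric])
  also have "\<dots> \<le> 4 * (4 * real d)\<^sup>2"
    using sum_h2 by (intro mult_left_mono power_mono sum_nonneg) auto
  finally have cov2: "(\<Sum>p\<in>off_pairs d. \<Sum>q\<in>off_pairs d. (cov i p q)\<^sup>2) \<le> 64 * real d ^ 2"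
    by (simp add: power_mult_distrib)
  have "(\<Sum>p\<in>off_pairs d. \<Sum>q\<in>off_pairs d. \<bar>cov i p q\<bar>) \<le> (\<Sum>p\<in>off_pairs d. \<Sum>q\<in>off_pairs d.
      \<bar>h (fst p) (fst q)\<bar> * \<bar>h (snd p) (snd q)\<bar> + \<bar>h (fst p) (snd q)\<bar> * \<bar>h (snd p) (fst q)\<bar>)"
    unfolding cov by (intro sum_mono) (metis abs_mult abs_triangle_ineq)
  also have "\<dots> \<le> (\<Sum>a<d. \<Sum>b<d. \<Sum>c<d. \<Sum>e<d. \<bar>h a c\<bar> * \<bar>h b e\<bar> + \<bar>h a e\<bar> * \<bar>h b c\<bar>)"
    by (rule sum_off_pairs_le[where
          F = "\<lambda>a b c e. \<bar>h a c\<bar> * \<bar>h b e\<bar> + \<bar>h a e\<bar> * \<bar>h b c\<bar>"]) simp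
  also have "\<dots> = 2 * (\<Sum>a<d. \<Sum>c<d. \<bar>h a c\<bar>)\<^sup>2" by (rule sum_wick_products)
  also have "\<dots> \<le> 2 * (2 * real d)\<^sup>2"
    using sum_h by (intro mult_left_mono power_mono sum_nonneg) auto
  finally have cov1: "(\<Sum>p\<in>off_pairs d. \<Sum>q\<in>off_pairs d. \<bar>cov i p q\<bar>) \<le> 8 * real d ^ 2"
    by (simp add: power_mult_distrib)
  \<comment> \<open>All means have the same absolute value |c| / d, so the cross term reduces to the
    sum of |cov|.\<close>
  have cross: "(\<Sum>p\<in>off_pairs d. \<Sum>q\<in>off_pairs d. cov i p q * (mean i p * mean i q)) \<le> 8 * c\<^sup>2"
  proof -
    have "(\<Sum>p\<in>off_pairs d. \<Sum>q\<in>off_pairs d. cov i p q * (mean i p * mean i q)) \<le>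
      (\<Sum>p\<in>off_pairs d. \<Sum>q\<in>off_pairs d. \<bar>cov i p q\<bar> * (c\<^sup>2 / real d ^ 2))"
    proof (intro sum_mono)
      fix p q assume "p \<in> off_pairs d" "q \<in> off_pairs d"
      then have "\<bar>mean i p * mean i q\<bar> = c\<^sup>2 / real d ^ 2"
        by (simp add: abs_mult mean_spiked[where x = x, OF x S] power2_eq_square)
      then show "cov i p q * (mean i p * mean i q) \<le> \<bar>cov i p q\<bar> * (c\<^sup>2 / real d ^ 2)"
        by (metis abs_ge_self abs_mult)
    qed
    also have "\<dots> = (\<Sum>p\<in>off_pairs d. \<Sum>q\<in>off_pairs d. \<bar>cov i p q\<bar>) * (c\<^sup>2 / real d ^ 2)"
      by (simp only: sum_distrib_right)
    also have "\<dots> \<le> (8 * real d ^ 2) * (c\<^sup>2 / real d ^ 2)"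
      by (intro mult_right_mono cov1) simp
    finally show ?thesis using d_pos by simp
  qed
  have "block_var i = real n ^ 2 * (\<Sum>p\<in>off_pairs d. \<Sum>q\<in>off_pairs d. (cov i p q)\<^sup>2) +
      2 * real n ^ 3 * (\<Sum>p\<in>off_pairs d. \<Sum>q\<in>off_pairs d. cov i p q * (mean i p * mean i q))"
    by (simp add: block_var_def sum.distrib sum_distrib_left)
  also have "\<dots> \<le> real n ^ 2 * (64 * real d ^ 2) + 2 * real n ^ 3 * (8 * c\<^sup>2)"
    by (intro add_mono mult_left_mono cov2 cross) auto
  finally show ?thesis by (simp add: mult_ac)
qed

text \<open>Covers both hypotheses: the null case is \<open>lam = 0\<close> with all
  \<open>c i = 0\<close>, the planted case has \<open>c i\<close> equal to \<open>lam\<close> up to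
  sign.\<close>

lemma chebyshev_total:
  assumes x: "\<And>a. a < d \<Longrightarrow> (x a)\<^sup>2 = 1 / real d"
    and S: "\<And>i. i < d \<Longrightarrow> S i = spiked_cov (c i) x" and c: "\<And>i. i < d \<Longrightarrow> (c i)\<^sup>2 = lam\<^sup>2"
    and lam: "0 \<le> lam" "lam \<le> 1" and "0 < t"
  shows "measure M {y \<in> space M. t \<le> \<bar>total y - real n ^ 2 * lam\<^sup>2 * (real d - 1) / 2\<bar>} \<le>
    (64 * real n ^ 2 * real d ^ 3 + 16 * real n ^ 3 * lam\<^sup>2 * real d) / t\<^sup>2"
proof -
  interpret prob_space M by (rule prob_space_M)
  let ?E = "real n ^ 2 * lam\<^sup>2 * (real d - 1) / 2"
  have "block_mean i = real n ^ 2 * lam\<^sup>2 * (real d - 1) / (2 * real d)" if "i < d" for i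
    using block_mean_spiked[where x = x, OF x S[OF that]] c[OF that] by simp
  then have E: "(\<Sum>i<d. block_mean i) = ?E" using d_pos by simp
  then have exp: "expectation total = ?E"
    using has_bochner_integral_total by (simp add: has_bochner_integral_iff)
  have "block_var i \<le> 64 * real n ^ 2 * real d ^ 2 + 16 * real n ^ 3 * lam\<^sup>2" if "i < d" for i
  proof -
    have "\<bar>c i\<bar> \<le> 1" using c[OF that] lam by (metis abs_le_square_iff abs_of_nonneg order_trans)
    from block_var_spiked_le[where x = x, OF x S[OF that] this] show ?thesis by (simp add: c[OF that])
  qed
  then have "(\<Sum>i<d. block_var i) \<le> (\<Sum>i<d. 64 * real n ^ 2 * real d ^ 2 + 16 * real n ^ 3 * lam\<^sup>2)"
    by (intro sum_mono) simp
  then have V: "variance total \<le> 64 * real n ^ 2 * real d ^ 3 + 16 * real n ^ 3 * lam\<^sup>2 * real d"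
  proof -
    have "variance total = (\<Sum>i<d. block_var i)" using variance_total by (simp only: E exp)
    also have "\<dots> \<le> real d * (64 * real n ^ 2 * real d ^ 2 + 16 * real n ^ 3 * lam\<^sup>2)"
      using \<open>(\<Sum>i<d. block_var i) \<le> _\<close> by simp
    finally show ?thesis by (simp add: power2_eq_square power3_eq_cube algebra_simps)
  qed
  have "prob {y \<in> space M. t \<le> \<bar>total y - expectation total\<bar>} \<le> variance total / t\<^sup>2"
    using has_bochner_integral_total has_bochner_integral_total_square \<open>0 < t\<close>
    by (intro Chebyshev_inequality) (auto simp: has_bochner_integral_iff)
  also have "\<dots> \<le> (64 * real n ^ 2 * real d ^ 3 + 16 * real n ^ 3 * lam\<^sup>2 * real d) / t\<^sup>2"
    using V by (rule divide_right_mono) simp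
  finally show ?thesis unfolding exp .
qed

lemma measurable_total: "total \<in> borel_measurable M"
  using has_bochner_integral_total by (auto elim: has_bochner_integral.cases)

end

section \<open>Error probabilities\<close>

lemma block_model_null:
  assumes "1 \<le> d" "1 \<le> m"
  shows "block_model d m (m div 2) (\<lambda>_. spiked_cov 0 x) (\<lambda>_. std_gaussian d)"
proof -
  have "spiked_cov 0 x = (\<lambda>a b. of_bool (a = b))" by (auto simp: spiked_cov_def fun_eq_iff)
  then show ?thesis using assms gaussian_moments_std_gaussian[of d] by unfold_locales auto
qed

lemma block_model_planted:
  assumes "1 \<le> d" "1 \<le> m" and x: "\<And>a. a < d \<Longrightarrow> (x a)\<^sup>2 = 1 / real d"
    and s: "\<And>i. i < d \<Longrightarrow> (s i)\<^sup>2 = 1" and "0 \<le> lam" "lam \<le> 1"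
  shows "block_model d m (m div 2) (\<lambda>i. spiked_cov (s i * lam) x)
    (\<lambda>i. gaussian d (spiked_cov (s i * lam) x))"
proof unfold_locales
  fix i assume "i < d"
  have "(\<Sum>a<d. (x a)\<^sup>2) = 1" using x \<open>1 \<le> d\<close> by simp
  moreover have "-1 \<le> s i * lam"
    using s[OF \<open>i < d\<close>] assms(5,6) by (auto simp: power2_eq_1_iff)
  ultimately show "gaussian_moments d (spiked_cov (s i * lam) x) (gaussian d (spiked_cov (s i * lam) x))"
    by (intro gaussian_moments_gaussian spiked_cov_has_factor)
qed (use assms in auto)

definition sample_space :: "nat \<Rightarrow> nat \<Rightarrow> (nat \<Rightarrow> nat \<Rightarrow> real) measure" where
  "sample_space d m = PiM {..<m * d} (\<lambda>_. PiM {..<d} (\<lambda>_. borel))"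

text \<open>Integrability in any instance of \<open>block_model\<close> includes measurability, and
  the sigma-algebra is the same for all instances, so the null instance is enough.\<close>

lemma stat_measurable:
  assumes "1 \<le> d" "1 \<le> m"
  shows "stat d m \<in> borel_measurable (sample_space d m)"
proof -
  interpret block_model d m "m div 2" "\<lambda>_. spiked_cov 0 (\<lambda>_. 0)" "\<lambda>_. std_gaussian d"
    by (rule block_model_null[OF assms])
  have "total = stat d m" by (simp add: fun_eq_iff total_def stat_def)
  then show ?thesis
    using measurable_total measurable_cong_sets[OF sets_M refl[of "sets (borel :: real measure)"]] by (simp add: sample_space_def)
qed

lemma spike_test_measurable:
  assumes "1 \<le> d" "1 \<le> m"
  shows "{y \<in> space (sample_space d m). spike_test d m y = v} \<in> sets (sample_space d m)"
proof -
  note [measurable] = stat_measurable[OF assms]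
  have "{y \<in> space (sample_space d m). spike_test d m y = v} = {y \<in> space (sample_space d m).
      (if real (m div 2) ^ 2 * real d ^ 3 * real (ceillog2 d) < stat d m y ^ 2 then v = Planted else v = Null)}"
    by (auto simp: spike_test_def)
  also have "\<dots> \<in> sets (sample_space d m)" by measurable
  finally show ?thesis .
qed

lemma null_error:
  assumes "2 \<le> d" "2 \<le> m"
  shows "1 - 64 / ceillog2 d \<le>
    measure (null_dist d m) {y \<in> space (null_dist d m). spike_test d m y = Null}"
proof -
  define n where "n = m div 2"
  \<comment> \<open>With coefficient 0 every vector gives the identity covariance; this one has the
    squared entries that \<open>chebyshev_total\<close> asks for.\<close>
  define x :: "nat \<Rightarrow> real" where "x = (\<lambda>_. 1 / sqrt d)"
  have dm: "1 \<le> d" "1 \<le> m" using assms by auto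
  interpret block_model d m n "\<lambda>_. spiked_cov 0 x" "\<lambda>_. std_gaussian d"
    unfolding n_def by (rule block_model_null[OF dm])
  interpret prob_space M by (rule prob_space_M)
  have M: "null_dist d m = M" by (simp add: M_def null_dist_def)
  have sets: "sets M = sets (sample_space d m)" by (simp add: sets_M sample_space_def)
  have ev: "{y \<in> space M. spike_test d m y = Null} \<in> sets M"
    using spike_test_measurable[OF dm] sets sets_eq_imp_space_eq[OF sets] by simp
  have total: "total = stat d m" unfolding fun_eq_iff total_def stat_def by (simp add: n_def)
  have l: "0 < ceillog2 d" using ceillog2_ge_iff[of d 1] assms by simp
  define t where "t = sqrt (real n ^ 2 * real d ^ 3 * real (ceillog2 d))"
  have n: "0 < n" using assms by (simp add: n_def)
  have t: "0 < t" "t\<^sup>2 = real n ^ 2 * real d ^ 3 * real (ceillog2 d)"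
    using l n dm by (auto simp: t_def)
  have "measure M {y \<in> space M. t \<le> \<bar>total y\<bar>} \<le> 64 * real n ^ 2 * real d ^ 3 / t\<^sup>2"
    using chebyshev_total[of x "\<lambda>_. 0" 0 t] t(1) dm by (simp add: x_def power_divide)
  also have "\<dots> = 64 / ceillog2 d" unfolding t(2) using n dm by simp
  finally have *: "measure M {y \<in> space M. t \<le> \<bar>total y\<bar>} \<le> 64 / ceillog2 d" .
  have "space M - {y \<in> space M. spike_test d m y = Null} \<subseteq> {y \<in> space M. t \<le> \<bar>total y\<bar>}"
  proof
    fix y assume y: "y \<in> space M - {y \<in> space M. spike_test d m y = Null}"
    then have "t\<^sup>2 \<le> (total y)\<^sup>2"
      unfolding t(2) total by (auto simp: spike_test_def n_def split: if_splits)
    then have "t \<le> \<bar>total y\<bar>" using t(1) by (simp flip: abs_le_square_iff)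
    then show "y \<in> {y \<in> space M. t \<le> \<bar>total y\<bar>}" using y by simp
  qed
  moreover have "{y \<in> space M. t \<le> \<bar>total y\<bar>} \<in> sets M"
    using measurable_total by measurable
  ultimately have "prob (space M - {y \<in> space M. spike_test d m y = Null}) \<le> 64 / ceillog2 d"
    using * finite_measure_mono by (meson order_trans)
  then show ?thesis unfolding M using prob_compl[OF ev] by simp
qed

text \<open>The threshold \<open>t\<close> is at most half the mean \<open>E\<close>, so a wrong
  verdict forces a deviation of at least \<open>E / 2\<close>. Chebyshev at \<open>E / 2\<close>
  then gives the bound.\<close>

lemma planted_error_cond:
  assumes d: "2 \<le> d" and m: "2 \<le> m" and x: "\<And>a. a < d \<Longrightarrow> (x a)\<^sup>2 = 1 / real d"
    and s: "\<And>i. i < d \<Longrightarrow> (s i)\<^sup>2 = 1" and lam: "0 \<le> lam" "lam \<le> 1"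
    and sep: "8 * (sqrt d * sqrt (ceillog2 d)) \<le> real (m div 2) * lam\<^sup>2"
  defines "P \<equiv> PiM {..<m * d} (\<lambda>j. gaussian d (spiked_cov (s (j div m) * lam) x))"
  shows "1 - 192 / ceillog2 d \<le> measure P {y \<in> space P. spike_test d m y = Planted}"
proof -
  define n where "n = m div 2"
  have dm: "1 \<le> d" "1 \<le> m" using d m by auto
  interpret block_model d m n "\<lambda>i. spiked_cov (s i * lam) x"
    "\<lambda>i. gaussian d (spiked_cov (s i * lam) x)"
    unfolding n_def by (rule block_model_planted[OF dm x s lam])
  interpret prob_space M by (rule prob_space_M)
  have M: "P = M" by (simp add: M_def P_def)
  have sets: "sets M = sets (sample_space d m)" by (simp add: sets_M sample_space_def)
  have ev: "{y \<in> space M. spike_test d m y = Planted} \<in> sets M"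
    using spike_test_measurable[OF dm] sets sets_eq_imp_space_eq[OF sets] by simp
  have total: "total = stat d m" unfolding fun_eq_iff total_def stat_def by (simp add: n_def)
  define l where "l = real (ceillog2 d)"
  have "0 < ceillog2 d" using ceillog2_ge_iff[of d 1] d by simp
  then have l: "1 \<le> l" by (simp add: l_def)
  have n: "1 \<le> real n" using m by (simp add: n_def)
  define t where "t = real n * (real d * (sqrt d * sqrt l))"
  define E where "E = real n ^ 2 * lam\<^sup>2 * (real d - 1) / 2"
  have "0 < t" using l n d by (simp add: t_def)
  moreover have "t\<^sup>2 = real n ^ 2 * real d ^ 3 * l"
    using l unfolding t_def power_mult_distrib by (simp add: power3_eq_cube power2_eq_square[of "real d"])
  ultimately have t: "0 < t" "t\<^sup>2 = real n ^ 2 * real d ^ 3 * l" by auto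
  \<comment> \<open>Here d \<le> 2 (d - 1), that is d \<ge> 2, absorbs the loss of the
    diagonal.\<close>
  have E4: "real n * (real d * (real n * lam\<^sup>2)) \<le> 4 * E"
  proof -
    have "(real n ^ 2 * lam\<^sup>2) * real d \<le> (real n ^ 2 * lam\<^sup>2) * (2 * (real d - 1))"
      using d by (intro mult_left_mono) auto
    also have "\<dots> = 4 * E" by (simp add: E_def)
    finally show ?thesis by (simp add: power2_eq_square mult_ac)
  qed
  \<comment> \<open>The 8 in the separation is 2 * 4: the 4 of \<open>E4\<close> and the wanted
    factor 2.\<close>
  have tE: "2 * t \<le> E"
  proof -
    have "real n * (real d * (8 * (sqrt d * sqrt l))) \<le> real n * (real d * (real n * lam\<^sup>2))"
      using sep unfolding n_def l_def by (intro mult_left_mono) auto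
    then show ?thesis using E4 by (simp add: t_def)
  qed
  then have E: "0 < E" using t(1) by linarith
  \<comment> \<open>Serves the variance term of order n^3 lam^2 d: it equals n l times a quantity
    below 4 E after multiplication by l, and n l is now below E / 2.\<close>
  have ltd: "real n * l \<le> t"
  proof -
    have "ceillog2 d \<le> d" using d by (simp add: ceillog2_le_iff less_imp_le)
    then have "l \<le> real d" by (simp add: l_def)
    moreover have "1 \<le> sqrt d * sqrt l" using l d by (simp flip: real_sqrt_mult) (use mult_mono[of 1 "real d" 1 l] in simp)
    ultimately have "l * 1 \<le> real d * (sqrt d * sqrt l)" by (intro mult_mono) auto
    then show ?thesis unfolding t_def by (intro mult_left_mono) auto
  qed
  have "measure M {y \<in> space M. E / 2 \<le> \<bar>total y - E\<bar>} \<le>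
      (64 * real n ^ 2 * real d ^ 3 + 16 * real n ^ 3 * lam\<^sup>2 * real d) / (E / 2)\<^sup>2"
    unfolding E_def
  proof (rule chebyshev_total[of x "\<lambda>i. s i * lam" lam])
    show "0 < real n ^ 2 * lam\<^sup>2 * (real d - 1) / 2 / 2" using E by (simp add: E_def)
  qed (use x s lam in \<open>auto simp: power_mult_distrib\<close>)
  also have "\<dots> \<le> 192 / l"
  proof -
    \<comment> \<open>The two variance terms, times \<open>l\<close>, are at most 16 E^2 and 32 E^2,
      and 48 E^2 = 192 (E / 2)^2.\<close>
    have "64 * (real n ^ 2 * real d ^ 3 * l) \<le> 16 * E\<^sup>2"
      unfolding t(2)[symmetric] using power_mono[OF tE, of 2] t(1) by (simp add: power_mult_distrib)
    moreover have "16 * (real n ^ 3 * lam\<^sup>2 * real d * l) \<le> 32 * E\<^sup>2"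
    proof -
      have "real n ^ 3 * lam\<^sup>2 * real d * l = (real n * (real d * (real n * lam\<^sup>2))) * (real n * l)"
        by (simp add: power3_eq_cube power2_eq_square)
      also have "\<dots> \<le> (4 * E) * (real n * l)" using E4 l by (intro mult_right_mono) auto
      also have "\<dots> \<le> (4 * E) * (E / 2)" using ltd tE E by (intro mult_left_mono) auto
      finally show ?thesis by (simp add: power2_eq_square[of E] mult_ac)
    qed
    ultimately have "(64 * real n ^ 2 * real d ^ 3 + 16 * real n ^ 3 * lam\<^sup>2 * real d) * l \<le> 192 * (E / 2)\<^sup>2"
      by (simp add: algebra_simps power_divide)
    then show ?thesis using E l by (simp add: divide_le_eq pos_le_divide_eq mult_ac)
  qed
  finally have *: "measure M {y \<in> space M. E / 2 \<le> \<bar>total y - E\<bar>} \<le> 192 / l" .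
  have "space M - {y \<in> space M. spike_test d m y = Planted} \<subseteq> {y \<in> space M. E / 2 \<le> \<bar>total y - E\<bar>}"
  proof
    fix y assume y: "y \<in> space M - {y \<in> space M. spike_test d m y = Planted}"
    then have "(total y)\<^sup>2 \<le> t\<^sup>2"
      unfolding t(2) total by (auto simp: spike_test_def n_def l_def split: if_splits)
    then have "\<bar>total y\<bar> \<le> t" using t(1) by (simp flip: abs_le_square_iff)
    then show "y \<in> {y \<in> space M. E / 2 \<le> \<bar>total y - E\<bar>}" using y tE by auto
  qed
  moreover have "{y \<in> space M. E / 2 \<le> \<bar>total y - E\<bar>} \<in> sets M"
    using measurable_total by measurable
  ultimately have "prob (space M - {y \<in> space M. spike_test d m y = Planted}) \<le> 192 / l"
    using * finite_measure_mono by (meson order_trans)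
  then show ?thesis unfolding M l_def using prob_compl[OF ev] by simp
qed

section \<open>Averaging over the prior, and the choice of the error bound\<close>

lemma set_pmf_spike_prior: "set_pmf (spike_prior d) = PiE {..<d} (\<lambda>_. {1 / sqrt d, - 1 / sqrt d})"
  and set_pmf_sign_prior: "set_pmf (sign_prior d) = PiE {..<d} (\<lambda>_. {1, -1})"
  unfolding spike_prior_def sign_prior_def
  by (rule set_pmf_of_set; auto simp: PiE_eq_empty_iff intro: finite_PiE)+

text \<open>The conditional bound is the same for all x and s in the support of the prior, so it
  survives integration.\<close>

lemma planted_error:
  assumes d: "2 \<le> d" and m: "2 \<le> m" and lam: "0 \<le> lam" "lam \<le> 1"
    and sep: "8 * (sqrt d * sqrt (ceillog2 d)) \<le> real (m div 2) * lam\<^sup>2"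
  shows "1 - 192 / ceillog2 d \<le>
    measure (planted_dist d m lam) {y \<in> space (planted_dist d m lam). spike_test d m y = Planted}"
proof -
  let ?p = "measure_pmf (pair_pmf (spike_prior d) (sign_prior d))"
  define f where "f = (\<lambda>(x, s). PiM {..<m * d} (\<lambda>j. gaussian d (spiked_cov (s (j div m) * lam) x)))"
  let ?X = "{y \<in> space (sample_space d m). spike_test d m y = Planted}"
  have sets_f: "sets (f w) = sets (sample_space d m)" for w
    unfolding f_def sample_space_def
    by (cases w) (auto simp: sets_gaussian intro!: sets_PiM_cong)
  have prob_f: "prob_space (f w)" for w
    unfolding f_def by (cases w) (auto intro!: prob_space_PiM prob_space_gaussian)
  have f: "f \<in> measurable ?p (subprob_algebra (sample_space d m))"
    using sets_f prob_f by (auto simp: space_subprob_algebra intro: prob_space_imp_subprob_space)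
  have X: "?X \<in> sets (sample_space d m)" using d m by (intro spike_test_measurable) auto
  have ge: "1 - 192 / ceillog2 d \<le> measure (f w) ?X" if "w \<in> set_pmf (pair_pmf (spike_prior d) (sign_prior d))" for w
  proof -
    obtain x s where w: "w = (x, s)" by (cases w)
    have "(x a)\<^sup>2 = 1 / real d" if "a < d" for a
    proof -
      have "x a \<in> {1 / sqrt d, - 1 / sqrt d}"
        using \<open>w \<in> _\<close> that unfolding w set_pair_pmf set_pmf_spike_prior by auto
      then show ?thesis by (auto simp: power_divide)
    qed
    moreover have "(s i)\<^sup>2 = 1" if "i < d" for i
    proof -
      have "s i \<in> {1, -1}"
        using \<open>w \<in> _\<close> that unfolding w set_pair_pmf set_pmf_sign_prior by auto
      then show ?thesis by auto
    qed
    ultimately show ?thesis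
      using planted_error_cond[OF d m _ _ lam sep, of x s] sets_eq_imp_space_eq[OF sets_f[of w]]
      by (simp add: w f_def)
  qed
  have planted: "planted_dist d m lam = ?p \<bind> f" by (simp add: planted_dist_def f_def)
  have "space (planted_dist d m lam) = space (sample_space d m)"
    unfolding planted by (rule space_bind[OF sets_f]) simp
  moreover have "measure (?p \<bind> f) ?X = (\<integral>w. measure (f w) ?X \<partial>?p)"
    by (rule measure_pmf.measure_bind[OF f X])
  moreover have "1 - 192 / ceillog2 d \<le> (\<integral>w. measure (f w) ?X \<partial>?p)"
    using ge prob_space.prob_le_1[OF prob_f]
    by (intro measure_pmf.integral_ge_const measure_pmf.integrable_const_bound[where B = 1])
      (auto simp: AE_measure_pmf_iff)
  ultimately show ?thesis unfolding planted by simp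
qed

text \<open>The trivial bound 1 covers the finitely many \<open>d\<close> too small for the separation below.\<close>

definition error_bound :: "nat \<Rightarrow> real" where
  "error_bound d = (if 2 \<le> d \<and> 576 * real (ceillog2 d) \<le> ln (real d) ^ 4
     then 192 / real (ceillog2 d) else 1)"

lemma error_bound_tendsto: "error_bound \<longlonglongrightarrow> 0"
proof (rule real_tendsto_sandwich)
  \<comment> \<open>The summand 1 accounts for the rounding up in \<open>ceillog2\<close>.\<close>
  have "\<forall>\<^sub>F d :: nat in sequentially. 576 * (log 2 (real d) + 1) \<le> ln (real d) ^ 4"
    by real_asymp
  then have *: "\<forall>\<^sub>F d in sequentially. error_bound d = 192 / real (ceillog2 d) \<and> 2 \<le> d"
    using eventually_ge_at_top[of 2]
  proof eventually_elim
    case (elim d)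
    then show ?case using ceillog2_less_log[of d] by (auto simp: error_bound_def)
  qed
  then show "\<forall>\<^sub>F d in sequentially. 0 \<le> error_bound d"
    by eventually_elim simp
  from * show "\<forall>\<^sub>F d in sequentially. error_bound d \<le> 192 / log 2 (real d)"
  proof eventually_elim
    case (elim d)
    have "0 < log 2 (real d)" "log 2 (real d) \<le> real (ceillog2 d)" "0 < ceillog2 d"
      using elim ceillog2_ge_log[of d] ceillog2_ge_iff[of d 1] by auto
    then show ?case using elim by (auto intro!: divide_left_mono mult_pos_pos)
  qed
  show "(\<lambda>d::nat. 192 / log 2 (real d)) \<longlonglongrightarrow> 0" by real_asymp
qed simp

text \<open>Squaring the hypothesis gives sqrt d L^2 \<le> m lam^2 with L = ln (d m), so L^2 has to
  dominate 24 sqrt(ceillog2 d). As the error bound may depend on \<open>d\<close> alone, this is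
  secured through ln d \<le> L. The 576 is 24^2, and 24 is the wanted 8 times the 3 lost in halving
  \<open>m\<close>.\<close>

lemma separation:
  assumes d: "2 \<le> d" and ln: "576 * real (ceillog2 d) \<le> ln (real d) ^ 4"
    and "1 \<le> m" and lam: "0 < lam" "lam < 1"
    and large: "real d powr (1/4) / sqrt (real m) * (ln (real (d * m))) powr 1 \<le> lam"
  shows "2 \<le> m" and "8 * (sqrt d * sqrt (ceillog2 d)) \<le> real (m div 2) * lam\<^sup>2"
proof -
  define L where "L = ln (real (d * m))"
  have lnL: "ln (real d) \<le> L" using d \<open>1 \<le> m\<close> by (simp add: L_def)
  have ln0: "0 < ln (real d)" using d by simp
  have "0 < ceillog2 d" using ceillog2_ge_iff[of d 1] d by simp
  then have l: "1 \<le> real (ceillog2 d)" by simp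
  have L: "24 * sqrt (ceillog2 d) \<le> L\<^sup>2"
  proof (rule power2_le_imp_le)
    have "(24 * sqrt (ceillog2 d))\<^sup>2 = 576 * real (ceillog2 d)" by (simp add: power_mult_distrib)
    also have "\<dots> \<le> L ^ 4" using ln power_mono[OF lnL, of 4] ln0 by linarith
    finally show "(24 * sqrt (ceillog2 d))\<^sup>2 \<le> (L\<^sup>2)\<^sup>2" by simp
  qed simp
  have d4: "(real d powr (1/4))\<^sup>2 = sqrt d"
    by (simp add: power2_eq_square powr_half_sqrt flip: powr_add)
  have L0: "0 < L" using lnL ln0 by linarith
  have "(real d powr (1/4) / sqrt (real m) * L)\<^sup>2 \<le> lam\<^sup>2"
    using large L0 unfolding L_def[symmetric] by (intro power_mono) auto
  then have lam2: "sqrt d * L\<^sup>2 \<le> real m * lam\<^sup>2"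
    using \<open>1 \<le> m\<close> by (simp add: power_mult_distrib power_divide d4 field_simps)
  have "1 \<le> sqrt (real d)" "1 \<le> sqrt (ceillog2 d)" using d l by auto
  have "24 * (sqrt d * sqrt (ceillog2 d)) \<le> real m * lam\<^sup>2"
    using mult_left_mono[OF L, of "sqrt d"] lam2 by simp
  moreover have "1 \<le> sqrt d * sqrt (ceillog2 d)"
    using mult_mono[OF \<open>1 \<le> sqrt (real d)\<close> \<open>1 \<le> sqrt (ceillog2 d)\<close>] by simp
  moreover have "real m * lam\<^sup>2 \<le> real m"
    using lam by (simp add: mult_left_le power_le_one)
  ultimately show "2 \<le> m" by linarith
  \<comment> \<open>The worst case is \<open>m = 3\<close>.\<close>
  then have "m \<le> 3 * (m div 2)" by linarith
  then have "real m \<le> 3 * real (m div 2)" by simp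
  then have "real m * lam\<^sup>2 \<le> 3 * real (m div 2) * lam\<^sup>2" by (intro mult_right_mono) auto
  with \<open>24 * _ \<le> real m * _\<close> show "8 * (sqrt d * sqrt (ceillog2 d)) \<le> real (m div 2) * lam\<^sup>2" by simp
qed

theorem lemma7p5:
  "\<exists>C::real. C > 0 \<and>
    (\<exists>\<A>. poly_time_test \<A> \<and>
      (\<exists>\<delta> :: nat \<Rightarrow> real. \<delta> \<longlonglongrightarrow> 0 \<and>
        (\<forall>d m :: nat. \<forall>lam :: real.
          d \<ge> 1 \<longrightarrow> m \<ge> 1 \<longrightarrow> 0 < lam \<longrightarrow> lam < 1 \<longrightarrow>
          lam \<ge> real d powr (1/4) / sqrt (real m) * (ln (real (d * m))) powr C \<longrightarrow>
          solves_testing \<A> d m lam (\<delta> d))))"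
proof -
  have "solves_testing spike_test d m lam (error_bound d)"
    if m: "1 \<le> m" and lam: "0 < lam" "lam < 1"
      and large: "real d powr (1/4) / sqrt (real m) * (ln (real (d * m))) powr 1 \<le> lam" for d m lam
  proof (cases "2 \<le> d \<and> 576 * real (ceillog2 d) \<le> ln (real d) ^ 4")
    case True
    then have d: "2 \<le> d" and ln: "576 * real (ceillog2 d) \<le> ln (real d) ^ 4" by auto
    note sep = separation[OF d ln m lam large]
    \<comment> \<open>One error bound serves both hypotheses, so the null error is enlarged to the
      planted one.\<close>
    have "64 / real (ceillog2 d) \<le> 192 / real (ceillog2 d)" by (rule divide_right_mono) auto
    then show ?thesis
      unfolding solves_testing_def error_bound_def
      using True null_error[OF d sep(1)] planted_error[OF d sep(1) _ _ sep(2)] lam by auto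
  next
    case False
    \<comment> \<open>With error 1 both requirements only say that a measure is nonnegative.\<close>
    then have "error_bound d = 1" by (simp only: error_bound_def if_False)
    then show ?thesis by (simp add: solves_testing_def)
  qed
  then show ?thesis
    using poly_time_spike_test error_bound_tendsto
    by (intro exI[of _ 1] conjI exI[of _ spike_test] exI[of _ error_bound]) auto
qed

end
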